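(* Let $M$ be a preGarside trickle monoid, i.e. $M=\mathrm{Tr}^+(\Gamma)$ for some preGarside trickle graph $\Gamma$. (1) Let $N$ be a parabolic submonoid of $M$. Then the embedding $N \hookrightarrow M$ induces an embedding $G (N) \hookrightarrow G (M)$ of enveloping groups. So, we can consider $G(N)$ as a subgroup of $G(M)$. (2) Let $N$ be a parabolic submonoid of $M$. Then $M \cap G(N) = N$ (inside $G(M)$). (3) Let $N_1$ and $N_2$ be two parabolic submonoids of $M$. Then $N_1 \cap N_2$ is a parabolic submonoid of $M$ and $G(N_1) \cap G (N_2) = G (N_1 \cap N_2)$ (inside $G(M)$).
   Context: **Trickle graphs.** For a simplicial graph $\Gamma$ (no loops or multiple edges, possibly infinite) with vertex set $V(\Gamma)$ and edge set $E(\Gamma)$, $\mathrm{star}_x(\Gamma)$ is the full subgraph spanned by $x$ and all vertices adjacent to $x$. A trickle graph is a quadruple $(\Gamma,\le,\mu,(\varphi_x)_{x\in V(\Gamma)})$ where $\Gamma$ is a simplicial graph, $\le$ is a partial order on $V(\Gamma)$, $\mu:V(\Gamma)\to\mathbb N_{\ge 2}\cup\{\infty\}$ is a labeling, and each $\varphi_x$ is a graph automorphism of $\mathrm{star}_x(\Gamma)$, such that, writing $x||y$ if $x\not\le y$ and $y\not\le x$, and $E_{||}(\Gamma)=\{\{x,y\}\in E(\Gamma)\mid x||y\}$: (a) if $x<y$ then $\{x,y\}\in E(\Gamma)$; (b) if $\{x,y\}\in E_{||}(\Gamma)$ and $z\le y$, then $\{x,z\}\in E_{||}(\Gamma)$;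 (c) for all $x$ and all $y,z\in \mathrm{star}_x(\Gamma)$: $z\le y$ iff $\varphi_x(z)\le\varphi_x(y)$; (d) for all $x$ and $y\in\mathrm{star}_x(\Gamma)$: if $\varphi_x(y)\ne y$ then $y<x$; (e) if $\mu(x)$ is finite, then $\varphi_x$ has finite order dividing $\mu(x)$; (f) $\mu(\varphi_x(y))=\mu(y)$ for all $x$ and $y\in \mathrm{star}_x(\Gamma)$; (g) if $z<y<x$ then $(\varphi_x\circ\varphi_y)(z)=(\varphi_{y'}\circ\varphi_x)(z)$ where $y'=\varphi_x(y)$. It is a preGarside trickle graph if $\mu(x)=\infty$ for all $x\in V(\Gamma)$. The preGarside trickle monoid is then given by the monoid presentation $\mathrm{Tr}^+(\Gamma)=\langle V(\Gamma)\mid \varphi_x(y)\,x=\varphi_y(x)\,y\text{ for all }\{x,y\}\in E(\Gamma)\rangle^+$. **Monoids.** $G(M)$ is the enveloping group of a monoid $M$, with natural homomorphism $\iota_M:M\to G(M)$. For $M=\mathrm{Tr}^+(\Gamma)$, $\iota_M$ is injective and $M$ is identified with its image. In $M$, $a\le_L b$ means $ac=b$ for some $c\in M$, and $a\le_R b$ means $c'a=b$ for some $c'\in M$; these are partial orders. $\mathrm{Tr}^+(\Gamma)$ is a preGarside monoid: it is cancellative, it is atomic (there is $\nu:M\to\mathbb N$ with $\nu(a)=0$ iff $a=1$ and $\nu(ab)\ge\nu(a)+\nu(b)$), and any two elements $a,b$ with a common upper bound for $\le_L$ (resp. $\le_R$) have a least upper bound $a\vee_L b$ (resp. $a\vee_R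 b$). A submonoid $N$ of a preGarside monoid $M$ is special if for all $a,b\in M$, $ab\in N$ implies $a,b\in N$. $N$ is a parabolic submonoid if it is special and, for all $a,b\in N$, if $a\vee_L b$ exists (in $M$) then $a\vee_L b\in N$, and if $a\vee_R b$ exists then $a\vee_R b\in N$. *)

theory Defs
  imports "HOL-Algebra.Algebra" "HOL-Library.Extended_Nat"
begin

section \<open>Trickle graphs\<close>

text \<open>A simplicial graph is given by its vertex set \<^term>\<open>V\<close> and its set \<^term>\<open>E\<close> of two-element
  subsets of \<^term>\<open>V\<close>.\<close>

definition simplicial_graph :: "'v set \<Rightarrow> 'v set set \<Rightarrow> bool" where
  "simplicial_graph V E \<longleftrightarrow> (\<forall>e\<in>E. \<exists>x\<in>V. \<exists>y\<in>V. x \<noteq> y \<and> e = {x, y})"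

definition star :: "'v set set \<Rightarrow> 'v \<Rightarrow> 'v set" where
  "star E x = insert x {y. {x, y} \<in> E}"

text \<open>Automorphisms of the full subgraph spanned by \<^term>\<open>S\<close>; the values outside
  \<^term>\<open>S\<close> are irrelevant.\<close>

definition graph_automorphism_on :: "'v set set \<Rightarrow> 'v set \<Rightarrow> ('v \<Rightarrow> 'v) \<Rightarrow> bool" where
  "graph_automorphism_on E S f \<longleftrightarrow>
     bij_betw f S S \<and> (\<forall>y\<in>S. \<forall>z\<in>S. {y, z} \<in> E \<longleftrightarrow> {f y, f z} \<in> E)"

locale trickle_graph =
  fixes V :: "'v set"
    and E :: "'v set set"
    and leq :: "'v \<Rightarrow> 'v \<Rightarrow> bool"  (infix "\<preceq>" 50)
    and \<mu> :: "'v \<Rightarrow> enat"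
    and \<phi> :: "'v \<Rightarrow> 'v \<Rightarrow> 'v"
  assumes graph: "simplicial_graph V E"
    and order: "partial_order_on V {(x, y). x \<in> V \<and> y \<in> V \<and> x \<preceq> y}"
    and label_ge_2: "x \<in> V \<Longrightarrow> \<mu> x \<ge> 2"
    and automorphism: "x \<in> V \<Longrightarrow> graph_automorphism_on E (star E x) (\<phi> x)"
    and less_adjacent: "\<lbrakk>x \<in> V; y \<in> V; x \<preceq> y; x \<noteq> y\<rbrakk> \<Longrightarrow> {x, y} \<in> E"
    and parallel_below:
      "\<lbrakk>x \<in> V; y \<in> V; z \<in> V; {x, y} \<in> E; \<not> x \<preceq> y; \<not> y \<preceq> x; z \<preceq> y\<rbrakk>
        \<Longrightarrow> {x, z} \<in> E \<and> \<not> x \<preceq> z \<and> \<not> z \<preceq> x"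
    and \<phi>_le_iff:
      "\<lbrakk>x \<in> V; y \<in> star E x; z \<in> star E x\<rbrakk> \<Longrightarrow> z \<preceq> y \<longleftrightarrow> \<phi> x z \<preceq> \<phi> x y"
    and \<phi>_moves_below: "\<lbrakk>x \<in> V; y \<in> star E x; \<phi> x y \<noteq> y\<rbrakk> \<Longrightarrow> y \<preceq> x \<and> y \<noteq> x"
    \<comment> \<open>\<^const>\<open>group.ord\<close> is 0 for elements of infinite order, and 0 does not divide \<open>n \<ge> 2\<close>.\<close>
    and \<phi>_order:
      "\<lbrakk>x \<in> V; \<mu> x = enat n\<rbrakk>
        \<Longrightarrow> group.ord (BijGroup (star E x)) (restrict (\<phi> x) (star E x)) dvd n"
    and \<mu>_\<phi>: "\<lbrakk>x \<in> V; y \<in> star E x\<rbrakk> \<Longrightarrow> \<mu> (\<phi> x y) = \<mu> y"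
    and \<phi>_\<phi>:
      "\<lbrakk>x \<in> V; y \<in> V; z \<in> V; z \<preceq> y; z \<noteq> y; y \<preceq> x; y \<noteq> x\<rbrakk>
        \<Longrightarrow> \<phi> x (\<phi> y z) = \<phi> (\<phi> x y) (\<phi> x z)"

locale preGarside_trickle_graph = trickle_graph +
  assumes label_infinite: "x \<in> V \<Longrightarrow> \<mu> x = \<infinity>"


section \<open>Monoid presentations\<close>

text \<open>The congruence generated by \<^term>\<open>R\<close> on the free monoid \<^term>\<open>lists S\<close>;
  \<^term>\<open>R\<close> should be contained in \<^term>\<open>lists S \<times> lists S\<close>.\<close>

inductive_set presentation_cong :: "'a set \<Rightarrow> ('a list \<times> 'a list) set \<Rightarrow> ('a list \<times> 'a list) set"
  for S R where
    relator: "\<lbrakk>(l, r) \<in> R; u \<in> lists S; v \<in> lists S\<rbrakk>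
      \<Longrightarrow> (u @ l @ v, u @ r @ v) \<in> presentation_cong S R"
  | refl: "w \<in> lists S \<Longrightarrow> (w, w) \<in> presentation_cong S R"
  | sym: "(w, w') \<in> presentation_cong S R \<Longrightarrow> (w', w) \<in> presentation_cong S R"
  | trans: "\<lbrakk>(w, w') \<in> presentation_cong S R; (w', w'') \<in> presentation_cong S R\<rbrakk>
      \<Longrightarrow> (w, w'') \<in> presentation_cong S R"

definition presented_monoid :: "'a set \<Rightarrow> ('a list \<times> 'a list) set \<Rightarrow> 'a list set monoid" where
  "presented_monoid S R =
    \<lparr>carrier = lists S // presentation_cong S R,
     monoid.mult = (\<lambda>A B. \<Union>a\<in>A. \<Union>b\<in>B. presentation_cong S R `` {a @ b}),
     one = presentation_cong S R `` {[]}\<rparr>"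

definition trickle_monoid :: "'v set \<Rightarrow> 'v set set \<Rightarrow> ('v \<Rightarrow> 'v \<Rightarrow> 'v) \<Rightarrow> 'v list set monoid" where
  "trickle_monoid V E \<phi> =
     presented_monoid V {([\<phi> x y, x], [\<phi> y x, y]) | x y. {x, y} \<in> E}"


section \<open>Enveloping groups\<close>

text \<open>The enveloping group of \<^term>\<open>M\<close> is the group generated by the elements of \<^term>\<open>M\<close>
  subject to the multiplication table of \<^term>\<open>M\<close>.  A generator is written \<^term>\<open>Inl a\<close>, its
  formal inverse \<^term>\<open>Inr a\<close>.\<close>

definition enveloping_relators :: "('a, 'b) monoid_scheme \<Rightarrow> (('a + 'a) list \<times> ('a + 'a) list) set"
  where
  "enveloping_relators M =
     {([Inl a, Inl b], [Inl (a \<otimes>\<^bsub>M\<^esub> b)]) | a b. a \<in> carrier M \<and> b \<in> carrier M}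
   \<union> {([Inl a, Inr a], []) | a. a \<in> carrier M}
   \<union> {([Inr a, Inl a], []) | a. a \<in> carrier M}"

definition enveloping_cong :: "('a, 'b) monoid_scheme \<Rightarrow> (('a + 'a) list \<times> ('a + 'a) list) set"
  where
  "enveloping_cong M = presentation_cong (carrier M <+> carrier M) (enveloping_relators M)"

definition enveloping_group :: "('a, 'b) monoid_scheme \<Rightarrow> ('a + 'a) list set monoid" where
  "enveloping_group M = presented_monoid (carrier M <+> carrier M) (enveloping_relators M)"

definition enveloping_hom :: "('a, 'b) monoid_scheme \<Rightarrow> 'a \<Rightarrow> ('a + 'a) list set" where
  "enveloping_hom M a = enveloping_cong M `` {[Inl a]}"

text \<open>The homomorphism between enveloping groups induced by a homomorphism \<^term>\<open>f\<close>
  with codomain \<^term>\<open>M\<close>.\<close>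

definition enveloping_map ::
    "('b, 'c) monoid_scheme \<Rightarrow> ('a \<Rightarrow> 'b) \<Rightarrow> ('a + 'a) list set \<Rightarrow> ('b + 'b) list set" where
  "enveloping_map M f A = (\<Union>w\<in>A. enveloping_cong M `` {map (map_sum f f) w})"

text \<open>For a submonoid \<^term>\<open>N\<close> of \<^term>\<open>M\<close>, the image of the enveloping group of \<^term>\<open>N\<close>
  under the homomorphism induced by the inclusion.\<close>

definition enveloping_image :: "('a, 'b) monoid_scheme \<Rightarrow> 'a set \<Rightarrow> ('a + 'a) list set set" where
  "enveloping_image M N = enveloping_map M (\<lambda>a. a) ` carrier (enveloping_group (M\<lparr>carrier := N\<rparr>))"


section \<open>Parabolic submonoids\<close>

definition le_L :: "('a, 'b) monoid_scheme \<Rightarrow> 'a \<Rightarrow> 'a \<Rightarrow> bool" where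
  "le_L M a b \<longleftrightarrow> (\<exists>c\<in>carrier M. a \<otimes>\<^bsub>M\<^esub> c = b)"

definition le_R :: "('a, 'b) monoid_scheme \<Rightarrow> 'a \<Rightarrow> 'a \<Rightarrow> bool" where
  "le_R M a b \<longleftrightarrow> (\<exists>c\<in>carrier M. c \<otimes>\<^bsub>M\<^esub> a = b)"

definition is_join :: "('a, 'b) monoid_scheme \<Rightarrow> ('a \<Rightarrow> 'a \<Rightarrow> bool) \<Rightarrow> 'a \<Rightarrow> 'a \<Rightarrow> 'a \<Rightarrow> bool" where
  "is_join M leq a b c \<longleftrightarrow>
     c \<in> carrier M \<and> leq a c \<and> leq b c \<and> (\<forall>d\<in>carrier M. leq a d \<and> leq b d \<longrightarrow> leq c d)"

definition special_submonoid :: "'a set \<Rightarrow> ('a, 'b) monoid_scheme \<Rightarrow> bool" where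
  "special_submonoid N M \<longleftrightarrow>
     submonoid N M \<and>
     (\<forall>a\<in>carrier M. \<forall>b\<in>carrier M. a \<otimes>\<^bsub>M\<^esub> b \<in> N \<longrightarrow> a \<in> N \<and> b \<in> N)"

definition parabolic_submonoid :: "'a set \<Rightarrow> ('a, 'b) monoid_scheme \<Rightarrow> bool" where
  "parabolic_submonoid N M \<longleftrightarrow>
     special_submonoid N M \<and>
     (\<forall>a\<in>N. \<forall>b\<in>N. \<forall>c. is_join M (le_L M) a b c \<longrightarrow> c \<in> N) \<and>
     (\<forall>a\<in>N. \<forall>b\<in>N. \<forall>c. is_join M (le_R M) a b c \<longrightarrow> c \<in> N)"


section \<open>Sanity checks\<close>

lemma presentation_cong_lists:
  assumes "(w, w') \<in> presentation_cong S R" "R \<subseteq> lists S \<times> lists S"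
  shows "w \<in> lists S \<and> w' \<in> lists S"
  using assms by (induction rule: presentation_cong.induct) auto

lemma presentation_cong_equiv:
  assumes "R \<subseteq> lists S \<times> lists S"
  shows "equiv (lists S) (presentation_cong S R)"
proof (rule equivI)
  show "presentation_cong S R \<subseteq> lists S \<times> lists S"
    using presentation_cong_lists[OF _ assms] by auto
  show "refl_on (lists S) (presentation_cong S R)"
    by (auto simp: refl_on_def intro: presentation_cong.refl)
  show "sym (presentation_cong S R)" by (meson presentation_cong.sym symI)
  show "trans (presentation_cong S R)" by (meson presentation_cong.trans transI)
qed

lemma presentation_cong_context:
  assumes "(w, w') \<in> presentation_cong S R" "u \<in> lists S" "v \<in> lists S"
  shows "(u @ w @ v, u @ w' @ v) \<in> presentation_cong S R"
  using assms
proof (induction rule: presentation_cong.induct)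
  case (relator l r u' v')
  then have "((u @ u') @ l @ (v' @ v), (u @ u') @ r @ (v' @ v)) \<in> presentation_cong S R"
    by (intro presentation_cong.relator) auto
  then show ?case by simp
next
  case (refl w)
  then show ?case by (intro presentation_cong.refl) auto
next
  case (sym w w')
  then show ?case by (simp add: presentation_cong.sym)
next
  case (trans w w' w'')
  then show ?case by (meson presentation_cong.trans)
qed

lemma presentation_cong_append:
  assumes R: "R \<subseteq> lists S \<times> lists S"
    and "(a, a') \<in> presentation_cong S R" "(b, b') \<in> presentation_cong S R"
  shows "(a @ b, a' @ b') \<in> presentation_cong S R"
proof -
  have "(a @ b, a' @ b) \<in> presentation_cong S R"
    using presentation_cong_context[OF assms(2), of "[]" b] presentation_cong_lists[OF assms(3) R]
    by simp
  moreover have "(a' @ b, a' @ b') \<in> presentation_cong S R"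
    using presentation_cong_context[OF assms(3), of a' "[]"] presentation_cong_lists[OF assms(2) R]
    by simp
  ultimately show ?thesis by (rule presentation_cong.trans)
qed

lemma presented_monoid_mult:
  assumes R: "R \<subseteq> lists S \<times> lists S" and "a \<in> lists S" "b \<in> lists S"
  shows "(presentation_cong S R `` {a}) \<otimes>\<^bsub>presented_monoid S R\<^esub> (presentation_cong S R `` {b})
       = presentation_cong S R `` {a @ b}"
proof -
  let ?c = "\<lambda>w. presentation_cong S R `` {w}"
  have eq: "?c (a' @ b') = ?c (a @ b)" if "a' \<in> ?c a" "b' \<in> ?c b" for a' b'
  proof -
    have "(a @ b, a' @ b') \<in> presentation_cong S R"
      using that by (intro presentation_cong_append[OF R]) simp_all
    then show ?thesis using equiv_class_eq[OF presentation_cong_equiv[OF R]] by metis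
  qed
  have "a \<in> ?c a" "b \<in> ?c b"
    using assms(2,3) by (simp_all only: Image_singleton_iff presentation_cong.refl)
  then have ne: "?c a \<noteq> {}" "?c b \<noteq> {}" by blast+
  have "?c a \<otimes>\<^bsub>presented_monoid S R\<^esub> ?c b = (\<Union>a'\<in>?c a. \<Union>b'\<in>?c b. ?c (a' @ b'))"
    by (simp only: presented_monoid_def monoid.simps)
  also have "\<dots> = (\<Union>a'\<in>?c a. \<Union>b'\<in>?c b. ?c (a @ b))"
    by (intro SUP_cong HOL.refl eq)
  also have "\<dots> = ?c (a @ b)" using ne by (simp only: UN_constant if_False)
  finally show ?thesis .
qed

lemma presented_monoid_is_monoid:
  assumes R: "R \<subseteq> lists S \<times> lists S"
  shows "monoid (presented_monoid S R)"
proof -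
  let ?c = "\<lambda>w. presentation_cong S R `` {w}"
  have carr: "carrier (presented_monoid S R) = ?c ` lists S"
    by (auto simp: presented_monoid_def quotient_def)
  have one: "\<one>\<^bsub>presented_monoid S R\<^esub> = ?c []" by (simp add: presented_monoid_def)
  have mult: "?c u \<otimes>\<^bsub>presented_monoid S R\<^esub> ?c v = ?c (u @ v)" if "u \<in> lists S" "v \<in> lists S" for u v
    using presented_monoid_mult[OF R that] .
  have app: "u @ v \<in> lists S" if "u \<in> lists S" "v \<in> lists S" for u v using that by simp
  have nil: "[] \<in> lists S" by simp
  show ?thesis
  proof (rule monoidI, unfold carr one, goal_cases)
    case (1 x y)
    then show ?case by (elim imageE, simp only: mult) (rule imageI, rule app)
  next
    case 2
    then show ?case using nil by (rule imageI)
  next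
    case (3 x y z)
    then show ?case by (elim imageE) (simp only: mult app append_assoc)
  next
    case (4 x)
    then show ?case by (elim imageE) (simp only: mult nil append_Nil)
  next
    case (5 x)
    then show ?case by (elim imageE) (simp only: mult nil append_Nil2)
  qed
qed

lemma trickle_relators_subset:
  assumes "trickle_graph V E leq \<mu> \<phi>"
  shows "{([\<phi> x y, x], [\<phi> y x, y]) | x y. {x, y} \<in> E} \<subseteq> lists V \<times> lists V"
proof -
  interpret trickle_graph V E leq \<mu> \<phi> by fact
  have V: "x \<in> V" "y \<in> V" if "{x, y} \<in> E" for x y
    using graph that unfolding simplicial_graph_def by (fastforce simp: doubleton_eq_iff)+
  have "\<phi> x y \<in> V" if "{x, y} \<in> E" for x y
  proof -
    have "\<phi> x y \<in> star E x"
      using automorphism[OF V(1)[OF that]] that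
      by (auto simp: graph_automorphism_on_def star_def dest: bij_betwE)
    then show ?thesis using V that by (auto simp: star_def)
  qed
  then show ?thesis using V by (auto simp: insert_commute)
qed

lemma trickle_monoid_is_monoid:
  "trickle_graph V E leq \<mu> \<phi> \<Longrightarrow> monoid (trickle_monoid V E \<phi>)"
  unfolding trickle_monoid_def by (intro presented_monoid_is_monoid trickle_relators_subset)

context
  fixes M :: "('a, 'b) monoid_scheme" (structure)
  assumes M: "monoid M"
begin

interpretation monoid M by (rule M)

lemma enveloping_relators_subset:
  "enveloping_relators M \<subseteq> lists (carrier M <+> carrier M) \<times> lists (carrier M <+> carrier M)"
  by (auto simp: enveloping_relators_def)

lemmas enveloping_equiv =
  presentation_cong_equiv[OF enveloping_relators_subset, folded enveloping_cong_def]

lemmas enveloping_mult =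
  presented_monoid_mult[OF enveloping_relators_subset,
    folded enveloping_cong_def enveloping_group_def]

lemma enveloping_carrier:
  "carrier (enveloping_group M) =
    {enveloping_cong M `` {w} | w. w \<in> lists (carrier M <+> carrier M)}"
  by (auto simp: enveloping_group_def presented_monoid_def enveloping_cong_def quotient_def)

lemma enveloping_one: "\<one>\<^bsub>enveloping_group M\<^esub> = enveloping_cong M `` {[]}"
  by (simp add: enveloping_group_def presented_monoid_def enveloping_cong_def)

lemma enveloping_rel:
  "(l, r) \<in> enveloping_relators M \<Longrightarrow> enveloping_cong M `` {l} = enveloping_cong M `` {r}"
  using presentation_cong.relator[of l r "enveloping_relators M" "[]" _ "[]"]
  by (intro equiv_class_eq[OF enveloping_equiv]) (simp add: enveloping_cong_def)

lemma enveloping_class_carrier: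
  "w \<in> lists (carrier M <+> carrier M) \<Longrightarrow> enveloping_cong M `` {w} \<in> carrier (enveloping_group M)"
  unfolding enveloping_carrier by blast

lemma enveloping_group_is_group: "group (enveloping_group M)"
proof -
  let ?G = "enveloping_group M" and ?c = "\<lambda>w. enveloping_cong M `` {w}"
  interpret G: monoid ?G
    unfolding enveloping_group_def
    by (rule presented_monoid_is_monoid[OF enveloping_relators_subset])
  have gen: "?c [s] \<in> Units ?G" if "s \<in> carrier M <+> carrier M" for s
  proof -
    from that obtain a where a: "a \<in> carrier M" "s = Inl a \<or> s = Inr a"
      by (elim PlusE) simp_all
    have l: "[Inl a] \<in> lists (carrier M <+> carrier M)" "[Inr a] \<in> lists (carrier M <+> carrier M)"
      using a(1) by (simp_all add: InlI InrI)
    have "([Inl a, Inr a], []) \<in> enveloping_relators M" "([Inr a, Inl a], []) \<in> enveloping_relators M"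
      using a(1) by (simp_all add: enveloping_relators_def)
    from this[THEN enveloping_rel]
    have inv: "?c [Inl a] \<otimes>\<^bsub>?G\<^esub> ?c [Inr a] = \<one>\<^bsub>?G\<^esub>" "?c [Inr a] \<otimes>\<^bsub>?G\<^esub> ?c [Inl a] = \<one>\<^bsub>?G\<^esub>"
      by (simp_all only: enveloping_mult[OF l(1) l(2)] enveloping_mult[OF l(2) l(1)]
          append_Cons append_Nil enveloping_one)
    note c = enveloping_class_carrier[OF l(1)] enveloping_class_carrier[OF l(2)]
    have "?c [Inl a] \<in> Units ?G"
      unfolding Units_def by (intro CollectI conjI bexI[of _ "?c [Inr a]"] c inv)
    moreover have "?c [Inr a] \<in> Units ?G"
      unfolding Units_def by (intro CollectI conjI bexI[of _ "?c [Inl a]"] c inv)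
    ultimately show ?thesis using a(2) by (elim disjE) simp_all
  qed
  have "?c w \<in> Units ?G" if "w \<in> lists (carrier M <+> carrier M)" for w
    using that
  proof (induction w rule: lists.induct)
    case Nil
    then show ?case using G.Units_one_closed by (simp only: enveloping_one)
  next
    case (Cons s w)
    have "[s] \<in> lists (carrier M <+> carrier M)" using Cons(1) by simp
    from enveloping_mult[OF this Cons(2)] G.Units_m_closed[OF gen[OF Cons(1)] Cons(3)]
    show ?case by (simp only: append_Cons append_Nil)
  qed
  then have units: "x \<in> Units ?G" if "x \<in> carrier ?G" for x
    using that unfolding enveloping_carrier by (elim CollectE exE conjE) simp
  show ?thesis by (rule G.group_l_invI) (rule G.Units_l_inv_ex[OF units])
qed

lemma enveloping_hom_is_hom: "enveloping_hom M \<in> hom M (enveloping_group M)"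
proof (rule homI)
  have l: "[Inl a] \<in> lists (carrier M <+> carrier M)" if "a \<in> carrier M" for a
    using that by (simp add: InlI)
  show "enveloping_hom M a \<in> carrier (enveloping_group M)" if "a \<in> carrier M" for a
    unfolding enveloping_hom_def by (rule enveloping_class_carrier[OF l[OF that]])
  show "enveloping_hom M (a \<otimes> b) = enveloping_hom M a \<otimes>\<^bsub>enveloping_group M\<^esub> enveloping_hom M b"
    if "a \<in> carrier M" "b \<in> carrier M" for a b
  proof -
    have "([Inl a, Inl b], [Inl (a \<otimes> b)]) \<in> enveloping_relators M"
      using that by (auto simp: enveloping_relators_def)
    from enveloping_rel[OF this] show ?thesis
      by (simp only: enveloping_hom_def enveloping_mult[OF l[OF that(1)] l[OF that(2)]]
          append_Cons append_Nil)
  qed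
qed

lemma enveloping_map_cong:
  assumes K: "monoid K" and f: "f \<in> hom K M" and w: "(w, w') \<in> enveloping_cong K"
  shows "(map (map_sum f f) w, map (map_sum f f) w') \<in> enveloping_cong M"
proof -
  have fin: "f a \<in> carrier M" if "a \<in> carrier K" for a using f that by (auto simp: hom_def)
  have lists: "map (map_sum f f) u \<in> lists (carrier M <+> carrier M)"
    if "u \<in> lists (carrier K <+> carrier K)" for u
    using that by (induction u rule: lists.induct) (auto simp: fin)
  show ?thesis
    using w unfolding enveloping_cong_def
  proof (induction rule: presentation_cong.induct)
    case (relator l r u v)
    have "(map (map_sum f f) l, map (map_sum f f) r) \<in> enveloping_relators M"
      using relator(1) f by (auto simp: enveloping_relators_def hom_def)
    from presentation_cong.relator[OF this lists[OF relator(2)] lists[OF relator(3)]]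
    show ?case by simp
  next
    case (refl w)
    then show ?case by (intro presentation_cong.refl lists)
  next
    case (sym w w')
    then show ?case by (simp only: presentation_cong.sym)
  next
    case (trans w w' w'')
    then show ?case by (meson presentation_cong.trans)
  qed
qed

lemma enveloping_map_class:
  assumes K: "monoid K" and f: "f \<in> hom K M" and w: "w \<in> lists (carrier K <+> carrier K)"
  shows "enveloping_map M f (enveloping_cong K `` {w}) = enveloping_cong M `` {map (map_sum f f) w}"
proof -
  have "w \<in> enveloping_cong K `` {w}"
    using w by (simp only: enveloping_cong_def Image_singleton_iff presentation_cong.refl)
  then have ne: "enveloping_cong K `` {w} \<noteq> {}" by blast
  have "enveloping_map M f (enveloping_cong K `` {w})
      = (\<Union>w'\<in>enveloping_cong K `` {w}. enveloping_cong M `` {map (map_sum f f) w})"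
    unfolding enveloping_map_def
  proof (intro SUP_cong HOL.refl)
    fix w' assume "w' \<in> enveloping_cong K `` {w}"
    then have "(map (map_sum f f) w, map (map_sum f f) w') \<in> enveloping_cong M"
      by (intro enveloping_map_cong[OF K f]) simp
    then show "enveloping_cong M `` {map (map_sum f f) w'} = enveloping_cong M `` {map (map_sum f f) w}"
      using equiv_class_eq[OF enveloping_equiv] by metis
  qed
  then show ?thesis using ne by (simp only: UN_constant if_False)
qed

lemma enveloping_map_enveloping_hom:
  assumes "monoid K" "f \<in> hom K M" "a \<in> carrier K"
  shows "enveloping_map M f (enveloping_hom K a) = enveloping_hom M (f a)"
  using enveloping_map_class[OF assms(1,2), of "[Inl a]"] assms(3)
  by (simp add: enveloping_hom_def InlI)

end

lemma enveloping_map_is_hom: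
  assumes M: "monoid M" and K: "monoid K" and f: "f \<in> hom K M"
  shows "enveloping_map M f \<in> hom (enveloping_group K) (enveloping_group M)"
proof -
  have fin: "f a \<in> carrier M" if "a \<in> carrier K" for a using f that by (auto simp: hom_def)
  have lists: "map (map_sum f f) u \<in> lists (carrier M <+> carrier M)"
    if "u \<in> lists (carrier K <+> carrier K)" for u
    using that by (induction u rule: lists.induct) (auto simp: fin)
  have app: "u @ v \<in> lists (carrier K <+> carrier K)"
    if "u \<in> lists (carrier K <+> carrier K)" "v \<in> lists (carrier K <+> carrier K)" for u v
    using that by simp
  show ?thesis
  proof (rule homI)
    fix x assume "x \<in> carrier (enveloping_group K)"
    then obtain u where u: "u \<in> lists (carrier K <+> carrier K)" "x = enveloping_cong K `` {u}"
      unfolding enveloping_carrier[OF K] by blast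
    then show "enveloping_map M f x \<in> carrier (enveloping_group M)"
      using enveloping_map_class[OF M K f u(1)] enveloping_class_carrier[OF M lists[OF u(1)]]
      by simp
  next
    fix x y assume "x \<in> carrier (enveloping_group K)" "y \<in> carrier (enveloping_group K)"
    then obtain u v where u: "u \<in> lists (carrier K <+> carrier K)" "x = enveloping_cong K `` {u}"
      and v: "v \<in> lists (carrier K <+> carrier K)" "y = enveloping_cong K `` {v}"
      unfolding enveloping_carrier[OF K] by blast
    show "enveloping_map M f (x \<otimes>\<^bsub>enveloping_group K\<^esub> y)
        = enveloping_map M f x \<otimes>\<^bsub>enveloping_group M\<^esub> enveloping_map M f y"
      by (simp only: u(2) v(2) enveloping_mult[OF K u(1) v(1)]
          enveloping_map_class[OF M K f app[OF u(1) v(1)]]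
          enveloping_map_class[OF M K f u(1)] enveloping_map_class[OF M K f v(1)]
          enveloping_mult[OF M lists[OF u(1)] lists[OF v(1)]] map_append)
  qed
qed

lemma enveloping_group_universal:
  assumes M: "monoid M" and H: "group H" and f: "f \<in> hom M H"
  shows "\<exists>h \<in> hom (enveloping_group M) H. \<forall>a\<in>carrier M. h (enveloping_hom M a) = f a"
proof -
  interpret H: group H by fact
  define ev where "ev = rec_list \<one>\<^bsub>H\<^esub>
    (\<lambda>s w y. (case s of Inl a \<Rightarrow> f a | Inr a \<Rightarrow> inv\<^bsub>H\<^esub> f a) \<otimes>\<^bsub>H\<^esub> y)"
  have ev_Nil: "ev [] = \<one>\<^bsub>H\<^esub>"
    and ev_Inl: "ev (Inl a # w) = f a \<otimes>\<^bsub>H\<^esub> ev w"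
    and ev_Inr: "ev (Inr a # w) = inv\<^bsub>H\<^esub> f a \<otimes>\<^bsub>H\<^esub> ev w" for a w
    by (simp_all add: ev_def)
  have fin: "f a \<in> carrier H" if "a \<in> carrier M" for a using f that by (auto simp: hom_def)
  have ev_closed: "ev w \<in> carrier H" if "w \<in> lists (carrier M <+> carrier M)" for w
    using that by (induction w rule: lists.induct) (auto simp: ev_Nil ev_Inl ev_Inr fin)
  have ev_append: "ev (u @ v) = ev u \<otimes>\<^bsub>H\<^esub> ev v"
    if "u \<in> lists (carrier M <+> carrier M)" "v \<in> lists (carrier M <+> carrier M)" for u v
    using that(1)
  proof (induction u rule: lists.induct)
    case Nil
    then show ?case using ev_closed[OF that(2)] by (simp add: ev_Nil)
  next
    case (Cons s u)
    then show ?case using ev_closed[OF Cons(2)] ev_closed[OF that(2)]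
      by (elim PlusE) (simp_all add: ev_Inl ev_Inr fin H.m_assoc)
  qed
  have ev_relator: "ev l = ev r" if "(l, r) \<in> enveloping_relators M" for l r
    using that f by (auto simp: enveloping_relators_def ev_Nil ev_Inl ev_Inr fin hom_mult)
  have ev_cong: "ev w = ev w'" if "(w, w') \<in> enveloping_cong M" for w w'
    using that unfolding enveloping_cong_def
  proof (induction rule: presentation_cong.induct)
    case (relator l r u v)
    have lr: "l \<in> lists (carrier M <+> carrier M)" "r \<in> lists (carrier M <+> carrier M)"
      using enveloping_relators_subset[OF M] relator(1) by blast+
    have "l @ v \<in> lists (carrier M <+> carrier M)" "r @ v \<in> lists (carrier M <+> carrier M)"
      using lr relator(3) by simp_all
    then show ?case using lr relator ev_relator[OF relator(1)] by (simp only: ev_append)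
  qed simp_all
  define h where "h x = ev (SOME w. w \<in> x)" for x
  have h: "h (enveloping_cong M `` {w}) = ev w" if "w \<in> lists (carrier M <+> carrier M)" for w
  proof -
    have "w \<in> enveloping_cong M `` {w}"
      using that by (simp only: enveloping_cong_def Image_singleton_iff presentation_cong.refl)
    then have "(SOME w'. w' \<in> enveloping_cong M `` {w}) \<in> enveloping_cong M `` {w}"
      by (rule someI)
    then have "(w, SOME w'. w' \<in> enveloping_cong M `` {w}) \<in> enveloping_cong M" by simp
    from ev_cong[OF this] show ?thesis by (simp only: h_def)
  qed
  have "h \<in> hom (enveloping_group M) H"
  proof (rule homI)
    fix x assume "x \<in> carrier (enveloping_group M)"
    then show "h x \<in> carrier H"
      unfolding enveloping_carrier[OF M] by (elim CollectE exE conjE) (simp only: h ev_closed)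
  next
    fix x y assume "x \<in> carrier (enveloping_group M)" "y \<in> carrier (enveloping_group M)"
    then obtain u v where u: "u \<in> lists (carrier M <+> carrier M)" "x = enveloping_cong M `` {u}"
      and v: "v \<in> lists (carrier M <+> carrier M)" "y = enveloping_cong M `` {v}"
      unfolding enveloping_carrier[OF M] by blast
    have uv: "u @ v \<in> lists (carrier M <+> carrier M)" using u(1) v(1) by simp
    show "h (x \<otimes>\<^bsub>enveloping_group M\<^esub> y) = h x \<otimes>\<^bsub>H\<^esub> h y"
      by (simp only: u(2) v(2) enveloping_mult[OF M u(1) v(1)] h[OF uv] h[OF u(1)] h[OF v(1)]
          ev_append[OF u(1) v(1)])
  qed
  moreover have "h (enveloping_hom M a) = f a" if "a \<in> carrier M" for a
    using h[of "[Inl a]"] that by (simp add: enveloping_hom_def ev_Inl ev_Nil fin InlI)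
  ultimately show ?thesis by blast
qed

end

theory Submission
  imports Defs
begin

text \<open>
  The three assertions are read off from a normal form in the enveloping group that does not depend
  on the ambient graph.  Since \<^term>\<open>x\<close> conjugates the star of \<^term>\<open>x\<close> by the permutation
  \<^term>\<open>\<phi> x\<close>, a signed letter \<open>x\<^sup>\<plusminus>\<^sup>1\<close> can be moved past an adjacent signed letter at the cost of
  turning the latter by a power \<open>\<plusminus>1\<close> of \<^term>\<open>\<phi> x\<close>.  Words in signed letters up to these moves form
  a monoid of the same kind as the trickle monoid, and the enveloping group is obtained from it by
  cancelling adjacent inverse letters.  Every element of the group is represented by a word to which
  no cancellation applies after any sequence of moves, and this reduced word is unique up to moves
  (\<open>reduced_form\<close>, \<open>act_act_res\<close>, \<open>M_value_normal_form\<close>).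

  Uniqueness rests on a Garside-type argument.  The moves satisfy a cube condition, which makes
  words with different first letters equal only through the least common multiple of these letters
  (\<open>sim_meet_at_lcm\<close>).  This gives cancellativity, and it shows that a letter acts on classes of
  reduced words, by prepending it or by cancelling it against an initial inverse letter, in a way
  that respects the relations.  The group acts on classes of reduced words, and the class of a
  reduced word is recovered as the image of the empty class.

  A parabolic submonoid \<open>N\<close> is generated by the set \<open>U\<close> of its vertices because it is special, and
  \<open>U\<close> is stable under every \<open>\<phi>\<^sub>x\<close> and \<open>\<phi>\<^sub>x\<^sup>-\<^sup>1\<close> with \<open>x\<close> in \<open>U\<close>: the right and left joins of two
  adjacent vertices \<open>x\<close>, \<open>y\<close> are the two-letter words in \<open>x\<close> and the turned vertex
  (\<open>parabolic_standard\<close>).  Hence moves and cancellations applied to a word over \<open>U\<close> and its inverses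
  stay over \<open>U\<close>, so the normal form of an element of \<open>G(N)\<close> is a word over \<open>U\<close> whether it is computed
  in \<open>G(N)\<close> or in \<open>G(M)\<close>.  Equal images in \<open>G(M)\<close> therefore mean equal normal forms already in \<open>G(N)\<close>,
  which is injectivity.  Positive words are reduced, so an element of \<open>M\<close> lying in \<open>G(N)\<close> has a
  positive normal form over \<open>U\<close>.  An element of \<open>G(N\<^sub>1)\<close> and \<open>G(N\<^sub>2)\<close> has a normal form over both
  vertex sets, hence over their intersection.
\<close>


section \<open>Alphabets with least common multiples\<close>

text \<open>The letter \<^term>\<open>res a b\<close> is the complement of \<^term>\<open>a\<close> in the least common right multiple of
\<^term>\<open>a\<close> and \<^term>\<open>b\<close>, which exists when they are adjacent: the defining relations are
\<open>a (res a b) = b (res b a)\<close>.  The cube condition says that complementing \<open>c\<close> along \<open>a\<close> and then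
along the rest of \<open>b\<close> agrees with complementing it along \<open>b\<close> and then along the rest of \<open>a\<close>.\<close>

locale complemented_alphabet =
  fixes adj :: "'a \<Rightarrow> 'a \<Rightarrow> bool"
    and res :: "'a \<Rightarrow> 'a \<Rightarrow> 'a"
  assumes adj_sym: "adj a b \<Longrightarrow> adj b a"
    and adj_irrefl: "\<not> adj a a"
    and res_adj_iff: "\<lbrakk>adj c a; adj c b\<rbrakk> \<Longrightarrow> adj (res c a) (res c b) \<longleftrightarrow> adj a b"
    and res_inj: "\<lbrakk>adj c a; adj c b; res c a = res c b\<rbrakk> \<Longrightarrow> a = b"
    and cube: "\<lbrakk>adj a b; adj b c; adj a c\<rbrakk> \<Longrightarrow> res (res a b) (res a c) = res (res b a) (res b c)"
begin

definition swaps :: "('a list \<times> 'a list) set" where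
  "swaps = {([a, res a b], [b, res b a]) | a b. adj a b}"

text \<open>The relation lives on all lists over the letter type; a letter without neighbours takes part in no
move, so letters that do not come from vertices are inert.\<close>

definition sim :: "'a list \<Rightarrow> 'a list \<Rightarrow> bool"  (infix "\<asymp>" 50) where
  "w \<asymp> w' \<longleftrightarrow> (w, w') \<in> presentation_cong UNIV swaps"

lemma sim_refl [simp]: "w \<asymp> w"
  by (simp add: sim_def presentation_cong.refl)

lemma sim_sym: "w \<asymp> w' \<Longrightarrow> w' \<asymp> w"
  by (simp add: sim_def presentation_cong.sym)

lemma sim_trans [trans]: "w \<asymp> w' \<Longrightarrow> w' \<asymp> w'' \<Longrightarrow> w \<asymp> w''"
  unfolding sim_def by (rule presentation_cong.trans)

lemma sim_append: "u \<asymp> u' \<Longrightarrow> v \<asymp> v' \<Longrightarrow> u @ v \<asymp> u' @ v'"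
  unfolding sim_def by (rule presentation_cong_append) simp_all

lemma sim_Cons: "w \<asymp> w' \<Longrightarrow> a # w \<asymp> a # w'"
  using sim_append[of "[a]" "[a]"] by simp

lemma sim_swap: "adj a b \<Longrightarrow> a # res a b # w \<asymp> b # res b a # w"
  using presentation_cong.relator[of "[a, res a b]" "[b, res b a]" swaps "[]" UNIV w]
  by (auto simp: sim_def swaps_def)

lemma sim_induct [consumes 1, case_names swap refl sym trans]:
  assumes "w \<asymp> w'"
    and "\<And>a b u v. adj a b \<Longrightarrow> P (u @ a # res a b # v) (u @ b # res b a # v)"
    and "\<And>w. P w w"
    and "\<And>w w'. w \<asymp> w' \<Longrightarrow> P w w' \<Longrightarrow> P w' w"
    and "\<And>w w' w''. w \<asymp> w' \<Longrightarrow> P w w' \<Longrightarrow> w' \<asymp> w'' \<Longrightarrow> P w' w'' \<Longrightarrow> P w w''"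
  shows "P w w'"
  using assms(1) unfolding sim_def
proof (induction rule: presentation_cong.induct)
  case (relator l r u v)
  then obtain a b where "adj a b" "l = [a, res a b]" "r = [b, res b a]"
    unfolding swaps_def by blast
  then show ?case using assms(2)[of a b u v] by simp
next
  case (refl w)
  show ?case by (rule assms(3))
next
  case (sym w w')
  then show ?case using assms(4) by (simp add: sim_def)
next
  case (trans w w' w'')
  then show ?case using assms(5) by (simp add: sim_def)
qed

lemma sim_length: "w \<asymp> w' \<Longrightarrow> length w = length w'"
  by (induction rule: sim_induct) simp_all

lemma sim_Nil_iff: "[] \<asymp> w \<longleftrightarrow> w = []"
  using sim_length by fastforce

text \<open>This relation is what equality of \<^term>\<open>w\<close> and \<^term>\<open>w'\<close> should amount to when one looks at
the first letters.  It contains the elementary moves, so that \<open>sim_meet_at_lcm\<close> reduces to its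
transitivity; that is where the cube condition is used.\<close>

fun meet_at_lcm :: "'a list \<Rightarrow> 'a list \<Rightarrow> bool" where
  "meet_at_lcm (a # w) (b # w') \<longleftrightarrow>
     a = b \<and> w \<asymp> w' \<or> adj a b \<and> (\<exists>u. w \<asymp> res a b # u \<and> w' \<asymp> res b a # u)"
| "meet_at_lcm w w' \<longleftrightarrow> w = w'"

lemma meet_at_lcm_refl: "meet_at_lcm w w"
  by (cases w) auto

lemma meet_at_lcm_sym: "meet_at_lcm w w' \<Longrightarrow> meet_at_lcm w' w"
  by (induction w w' rule: meet_at_lcm.induct) (auto intro: sim_sym adj_sym)

text \<open>Let the three words begin with \<open>a\<close>, \<open>c\<close> and \<open>b\<close>.  Cancelling \<open>c\<close>, the two given presentations of the
middle word become an equality of shorter words beginning with \<^term>\<open>res c a\<close> and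
\<^term>\<open>res c b\<close>, to which the claim for shorter words applies.  The common remainder \<open>t\<close> completes
the cube spanned by \<open>a\<close>, \<open>b\<close> and \<open>c\<close>, and the cube condition lets one leave the cube through the face
spanned by \<open>a\<close> and \<open>b\<close>.\<close>

lemma meet_at_lcm_trans:
  assumes shorter: "\<And>v v'. v \<asymp> v' \<Longrightarrow> length v < length w \<Longrightarrow> meet_at_lcm v v'"
    and "meet_at_lcm w w'" "meet_at_lcm w' w''" and len: "length w' = length w"
  shows "meet_at_lcm w w''"
proof (cases "w = [] \<or> w' = [] \<or> w'' = []")
  case True
  then show ?thesis using assms(2,3)
    by (cases w; cases w'; cases w'') auto
next
  case False
  then obtain a p c q b r where w: "w = a # p" "w' = c # q" "w'' = b # r"
    by (meson list.exhaust)
  consider "a = c" "p \<asymp> q" | "c = b" "q \<asymp> r"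
    | u v where "adj a c" "p \<asymp> res a c # u" "q \<asymp> res c a # u"
        "adj c b" "q \<asymp> res c b # v" "r \<asymp> res b c # v"
    using assms(2,3) unfolding w by auto
  then show ?thesis
  proof cases
    case 1
    then show ?thesis using assms(3) unfolding w by (auto intro: sim_trans)
  next
    case 2
    then show ?thesis using assms(2) unfolding w by simp (meson sim_trans sim_sym)
  next
    case 3
    have adj: "adj c a" "adj b c" using 3 adj_sym by blast+
    have *: "res c a # u \<asymp> res c b # v" using 3 by (blast intro: sim_trans sim_sym)
    have "length (res c a # u) < length w"
      using sim_length[OF 3(3)] len unfolding w by simp
    note m = shorter[OF * this]
    show ?thesis
    proof (cases "a = b")
      case True
      then have "u \<asymp> v" using m adj_irrefl by simp
      then have "p \<asymp> r" using 3 True by (blast intro: sim_trans sim_sym sim_Cons)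
      then show ?thesis using True w by simp
    next
      case False
      then have "res c a \<noteq> res c b" using res_inj 3 adj by blast
      then obtain t where t: "adj (res c a) (res c b)"
        "u \<asymp> res (res c a) (res c b) # t" "v \<asymp> res (res c b) (res c a) # t"
        using m by auto
      have ab: "adj a b" "adj b a" using t(1) res_adj_iff 3 adj adj_sym by blast+
      \<comment> \<open>Move around the cube from the faces at \<open>a\<close>, \<open>c\<close> and at \<open>b\<close>, \<open>c\<close> to the face at \<open>a\<close>, \<open>b\<close>.\<close>
      have "p \<asymp> res a c # res (res a c) (res a b) # t"
        using 3(2) sim_Cons[OF t(2)] cube[of a c b] 3 ab by (metis sim_trans)
      also have "\<dots> \<asymp> res a b # res (res a b) (res a c) # t"
        by (rule sim_swap) (use res_adj_iff 3 ab in blast)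
      finally have p: "p \<asymp> res a b # res (res a b) (res a c) # t" .
      have "r \<asymp> res b c # res (res b c) (res b a) # t"
        using 3(6) sim_Cons[OF t(3)] cube[of b c a] adj ab by (metis sim_trans)
      also have "\<dots> \<asymp> res b a # res (res b a) (res b c) # t"
        by (rule sim_swap) (use res_adj_iff adj ab in blast)
      finally have "r \<asymp> res b a # res (res a b) (res a c) # t"
        using cube[of a b c] ab adj 3 by metis
      then show ?thesis using p ab unfolding w by auto
    qed
  qed
qed

text \<open>The outer induction on the length supplies the hypothesis on shorter words in \<open>meet_at_lcm_trans\<close>; the
inner one follows the derivation of the equivalence.\<close>

lemma sim_meet_at_lcm: "w \<asymp> w' \<Longrightarrow> meet_at_lcm w w'"
proof (induction "length w" arbitrary: w w' rule: less_induct)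
  case less
  have "length w = n \<Longrightarrow> meet_at_lcm w w'" if "n = length w" for n
    using less.prems less.hyps[folded that]
  proof (induction rule: sim_induct)
    case (swap a b u v)
    show ?case
    proof (cases u)
      case Nil
      then show ?thesis using swap by (simp, intro disjI2 exI[of _ v]) simp
    next
      case (Cons c u')
      then show ?thesis
        using sim_append[OF sim_refl[of u'] sim_swap[OF swap(1)]] by simp
    qed
  next
    case (refl w)
    show ?case by (rule meet_at_lcm_refl)
  next
    case (sym w w')
    then show ?case using meet_at_lcm_sym sim_length by metis
  next
    case (trans w w' w'')
    show ?case
    proof (rule meet_at_lcm_trans)
      show "length w' = length w" using trans sim_length by metis
      then show "meet_at_lcm w' w''" "meet_at_lcm w w'" using trans by auto
    next
      fix v v' assume "v \<asymp> v'" "length v < length w"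
      then show "meet_at_lcm v v'" using trans by blast
    qed
  qed
  then show ?case by simp
qed

lemma sim_Cons_cancel: "a # w \<asymp> a # w' \<Longrightarrow> w \<asymp> w'"
  using sim_meet_at_lcm[of "a # w" "a # w'"] adj_irrefl by auto

lemma sim_Cons_lcm:
  assumes "a # w \<asymp> b # w'" "a \<noteq> b"
  obtains u where "adj a b" "w \<asymp> res a b # u" "w' \<asymp> res b a # u"
  using sim_meet_at_lcm[OF assms(1)] assms(2) by auto

end

section \<open>Formal inverses and reduced words\<close>

text \<open>Every letter has a formal inverse \<^term>\<open>bar a\<close> with the same neighbours.  Complementing by \<^term>\<open>a\<close>
acts on the neighbours of \<^term>\<open>a\<close> as a permutation that commutes with \<^term>\<open>bar\<close> and is inverted
by complementing by \<^term>\<open>bar a\<close>.  The identity \<open>res_res\<close> reflects that of two adjacent vertices of a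
trickle graph at most one moves the other.\<close>

locale signed_alphabet = complemented_alphabet +
  fixes bar :: "'a \<Rightarrow> 'a"
  assumes bar_bar [simp]: "bar (bar a) = a"
    and bar_adj: "adj a b \<Longrightarrow> adj (bar a) b"
    and res_bar: "adj a b \<Longrightarrow> res a (bar b) = bar (res a b)"
    and res_bar_res: "adj a b \<Longrightarrow> res (bar a) (res a b) = b"
    and res_res: "adj a b \<Longrightarrow> res (res b a) b = res a b"
    and adj_res: "adj a b \<Longrightarrow> adj a (res a b)"
begin

lemma bar_not_adj: "\<not> adj a (bar a)"
  using bar_adj[of a "bar a"] adj_irrefl by blast

lemma adj_res_res: "adj a b \<Longrightarrow> adj (res a b) (res b a)"
  using adj_res[of "res a b" a] adj_res[of a b] adj_sym res_res[of b a] by metis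

text \<open>Multiplying the relation \<open>a (res a b) = b (res b a)\<close> by formal inverses on both sides gives
\<open>a\<^sup>-\<^sup>1 b = (res a b) (res b a)\<^sup>-\<^sup>1\<close>.  This is again one of the defining moves.\<close>

lemma sim_slide:
  assumes "adj a b"
  shows "bar a # b # w \<asymp> res a b # bar (res b a) # w"
proof -
  have "adj a (res a b)" using assms by (rule adj_res)
  then have "bar a # res (bar a) (res a b) # w \<asymp> res a b # res (res a b) (bar a) # w"
    by (intro sim_swap bar_adj)
  moreover have "res (res a b) (bar a) = bar (res b a)"
    using res_bar[of "res a b" a] res_res[of b a] assms adj_res adj_sym by metis
  ultimately show ?thesis using res_bar_res[OF assms] by simp
qed

lemma res_bar_corner:
  assumes "adj a b"
  shows "res (bar (res a b)) (res b a) = a"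
    and "res (bar (res a b)) (bar (res b a)) = bar a"
proof -
  have c: "adj (res a b) a" using assms adj_res adj_sym by blast
  show *: "res (bar (res a b)) (res b a) = a"
    using res_bar_res[OF c] res_res[OF adj_sym[OF assms]] by simp
  show "res (bar (res a b)) (bar (res b a)) = bar a"
    using res_bar[OF bar_adj[OF adj_res_res[OF assms]]] * by simp
qed

text \<open>Formal inversion of words respects the moves.  It exchanges left and right divisibility, so that
the statements on first letters transfer to last letters.\<close>

lemma sim_bar_rev: "w \<asymp> w' \<Longrightarrow> map bar (rev w) \<asymp> map bar (rev w')"
proof (induction rule: sim_induct)
  case (swap a b u v)
  have "adj (bar (res a b)) (bar (res b a))"
    using adj_res_res[OF swap] bar_adj adj_sym by blast
  from sim_swap[OF this, of "map bar (rev u)"]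
  have "bar (res a b) # bar a # map bar (rev u) \<asymp> bar (res b a) # bar b # map bar (rev u)"
    using res_bar_corner(2) swap adj_sym by simp
  from sim_append[OF sim_refl[of "map bar (rev v)"] this] show ?case by simp
qed (auto intro: sim_sym sim_trans)

lemma sim_snoc_lcm:
  assumes "p @ [a] \<asymp> q @ [b]" "a \<noteq> b"
  obtains u where "adj a b" "p \<asymp> u @ [res (bar a) b]"
proof -
  have "bar a # map bar (rev p) \<asymp> bar b # map bar (rev q)"
    using sim_bar_rev[OF assms(1)] by simp
  then obtain u where u: "adj (bar a) (bar b)" "map bar (rev p) \<asymp> res (bar a) (bar b) # u"
    using assms(2) sim_Cons_lcm bar_bar by metis
  have adj: "adj a b" using u(1) bar_adj adj_sym bar_bar by metis
  have "bar \<circ> bar = id" by (simp add: fun_eq_iff)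
  then have "p \<asymp> map bar (rev u) @ [bar (res (bar a) (bar b))]"
    using sim_bar_rev[OF u(2)] by (simp add: rev_map)
  then have "p \<asymp> map bar (rev u) @ [res (bar a) b]"
    using res_bar[of "bar a" b] adj bar_adj by simp
  then show ?thesis using that adj by blast
qed

definition reduced :: "'a list \<Rightarrow> bool" where
  "reduced w \<longleftrightarrow> \<not> (\<exists>u a v. w \<asymp> u @ a # bar a # v)"

lemma reduced_Nil: "reduced []"
  by (simp add: reduced_def sim_Nil_iff)

lemma reduced_sim: "reduced w \<Longrightarrow> w \<asymp> w' \<Longrightarrow> reduced w'"
  unfolding reduced_def by (meson sim_trans)

lemma reduced_ConsD: "reduced (a # w) \<Longrightarrow> reduced w"
  unfolding reduced_def by (metis sim_Cons append_Cons)

lemma reduced_no_inverse: "reduced (a # w) \<Longrightarrow> \<not> w \<asymp> bar a # v"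
  unfolding reduced_def by (metis sim_Cons append_Nil)

text \<open>When prepending \<open>a\<close> to a reduced word creates a cancellation, the cancelling partner of \<open>a\<close> can be
moved to the front of that word.  If the pair starts later than the first letter \<open>c\<close> of the second
word, then either \<open>a = c\<close> cancels, or both words factor through the least common multiple of \<open>a\<close> and
\<open>c\<close>; by induction the remaining factor begins with the inverse of \<^term>\<open>res c a\<close>, and \<open>sim_slide\<close>
turns this inverse into the inverse of \<open>a\<close> at the front.\<close>

lemma cancelling_prefix:
  assumes "reduced w" "a # w \<asymp> u @ b # bar b # t"
  shows "\<exists>v. w \<asymp> bar a # v"
  using assms
proof (induction u arbitrary: a w)
  case Nil
  show ?case
  proof (cases "a = b")
    case True
    then show ?thesis using Nil sim_Cons_cancel by fastforce
  next
    case False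
    then obtain s where s: "adj a b" "w \<asymp> res a b # s" "bar b # t \<asymp> res b a # s"
      using Nil(2) sim_Cons_lcm[of a w b "bar b # t"] by auto
    have d: "adj b (res b a)" using s adj_res adj_sym by blast
    then have ne: "bar b \<noteq> res b a" using bar_not_adj by metis
    obtain r where "s \<asymp> res (res b a) (bar b) # r"
      using s(3) ne by (rule sim_Cons_lcm) blast
    moreover have "res (res b a) (bar b) = bar (res a b)"
      using res_bar[of "res b a" b] d adj_sym res_res[of a b] s(1) by metis
    ultimately have "w \<asymp> [] @ res a b # bar (res a b) # r"
      using s(2) sim_trans sim_Cons by (metis append_Nil)
    then show ?thesis using Nil(1) unfolding reduced_def by blast
  qed
next
  case (Cons c u)
  show ?case
  proof (cases "a = c")
    case True
    then have "w \<asymp> u @ b # bar b # t" using Cons(3) sim_Cons_cancel by auto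
    then show ?thesis using Cons(2) unfolding reduced_def by blast
  next
    case False
    then obtain s where s: "adj a c" "w \<asymp> res a c # s" "u @ b # bar b # t \<asymp> res c a # s"
      using Cons(3) sim_Cons_lcm[of a w c "u @ b # bar b # t"] by auto
    have "reduced s" using Cons(2) s(2) reduced_sim reduced_ConsD by blast
    then obtain v where "s \<asymp> bar (res c a) # v" using Cons.IH s(3) sim_sym by blast
    then have "w \<asymp> res a c # bar (res c a) # v" using s(2) sim_trans sim_Cons by blast
    then show ?thesis using sim_slide[OF s(1)] sim_sym sim_trans by blast
  qed
qed

lemma reduced_Cons_iff: "reduced w \<Longrightarrow> reduced (a # w) \<longleftrightarrow> (\<forall>v. \<not> w \<asymp> bar a # v)"
  using cancelling_prefix[of w a] reduced_no_inverse unfolding reduced_def by blast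

definition cls :: "'a list \<Rightarrow> 'a list set" where
  "cls w = {w'. w \<asymp> w'}"

lemma cls_eq_iff: "cls w = cls w' \<longleftrightarrow> w \<asymp> w'"
  unfolding cls_def by (auto intro: sim_trans sim_sym)

text \<open>The action on all sets of words is the identity outside the classes of reduced words; so the group
of all permutations of sets of words can serve as the target of the action.\<close>

definition act :: "'a \<Rightarrow> 'a list set \<Rightarrow> 'a list set" where
  "act a Z =
    (if Z \<notin> cls ` Collect reduced then Z
     else if \<exists>v. bar a # v \<in> Z then cls (SOME v. bar a # v \<in> Z)
     else cls (a # (SOME w. w \<in> Z)))"

lemma act_cancel:
  assumes "reduced w" "w \<asymp> bar a # v"
  shows "act a (cls w) = cls v"
proof -
  have "bar a # v \<in> cls w" using assms by (simp add: cls_def)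
  then have "bar a # (SOME v. bar a # v \<in> cls w) \<in> cls w" by (rule someI)
  then have "bar a # v \<asymp> bar a # (SOME v. bar a # v \<in> cls w)"
    using assms unfolding cls_def by (auto intro: sim_trans sim_sym)
  then have "cls (SOME v. bar a # v \<in> cls w) = cls v"
    using sim_Cons_cancel cls_eq_iff by metis
  then show ?thesis unfolding act_def using assms \<open>bar a # v \<in> cls w\<close> by auto
qed

lemma act_Cons:
  assumes "reduced (a # w)"
  shows "act a (cls w) = cls (a # w)"
proof -
  have r: "reduced w" using assms by (rule reduced_ConsD)
  have "w \<in> cls w" by (simp add: cls_def)
  then have "(SOME w'. w' \<in> cls w) \<in> cls w" by (rule someI)
  then have "cls (a # (SOME w'. w' \<in> cls w)) = cls (a # w)"
    by (simp add: cls_eq_iff) (simp add: cls_def sim_Cons sim_sym)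
  then show ?thesis
    unfolding act_def using r reduced_no_inverse[OF assms] by (auto simp: cls_def)
qed

lemma act_cases:
  assumes "reduced w"
  obtains v where "w \<asymp> bar a # v" "reduced v" "act a (cls w) = cls v"
  | "\<And>v. \<not> w \<asymp> bar a # v" "reduced (a # w)" "act a (cls w) = cls (a # w)"
  using act_cancel act_Cons assms reduced_Cons_iff reduced_sim reduced_ConsD by metis

lemma act_inverse: "act a (act (bar a) Z) = Z"
proof (cases "Z \<in> cls ` Collect reduced")
  case False
  then show ?thesis by (simp add: act_def)
next
  case True
  then obtain w where w: "Z = cls w" "reduced w" by blast
  show ?thesis
  proof (cases rule: act_cases[OF w(2), of "bar a"])
    case (1 v)
    then have "w \<asymp> a # v" by simp
    then show ?thesis
      using act_Cons[of a v] 1 w reduced_sim cls_eq_iff sim_sym by metis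
  next
    case 2
    then show ?thesis using act_cancel[of "bar a # w" a w] w by simp
  qed
qed

text \<open>Write \<open>c\<close> and \<open>d\<close> for \<^term>\<open>res a b\<close> and \<^term>\<open>res b a\<close>, and let \<open>w\<close> be reduced.  If \<open>w\<close> begins with
neither inverse of \<open>c\<close> and \<open>d\<close>, both sides prepend the same two-letter element (\<open>no_inverse\<close>).  If it
begins with both, it begins with their least common multiple, and both sides cancel it.  If \<open>w\<close> is \<open>c\<^sup>-\<^sup>1v\<close> but
does not begin with \<open>d\<^sup>-\<^sup>1\<close>, the left side prepends \<open>a\<close> to \<open>v\<close>; on the right, \<open>d c\<^sup>-\<^sup>1v\<close> is
\<open>b\<^sup>-\<^sup>1a v\<close> by \<open>sim_slide\<close>, and \<open>b\<close> cancels (\<open>mixed\<close>).\<close>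

lemma act_act_res:
  assumes "adj a b"
  shows "act a (act (res a b) Z) = act b (act (res b a) Z)"
proof (cases "Z \<in> cls ` Collect reduced")
  case False
  then show ?thesis by (simp add: act_def)
next
  case True
  then obtain w where w: "Z = cls w" "reduced w" by blast
  have mixed: "act a (cls v) = act b (cls (res b a # w))"
    if ab: "adj a b" and v: "w \<asymp> bar (res a b) # v" "reduced v"
      and r: "reduced (res b a # w)" for a b v
  proof -
    have "res b a # w \<asymp> res b a # bar (res a b) # v" using v(1) by (rule sim_Cons)
    also have "\<dots> \<asymp> bar b # a # v" using sim_slide[of b a v] ab adj_sym sim_sym by blast
    finally have s: "res b a # w \<asymp> bar b # a # v" .
    then have "reduced (a # v)" using r reduced_sim reduced_ConsD by blast
    then show ?thesis using act_Cons act_cancel[OF r s] by simp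
  qed
  have no_inverse: "reduced (a # res a b # w)"
    if ab: "adj a b" and nd: "\<And>v. \<not> w \<asymp> bar (res b a) # v" and r: "reduced (res a b # w)"
    for a b
  proof (rule ccontr)
    assume "\<not> reduced (a # res a b # w)"
    then obtain v where v: "res a b # w \<asymp> bar a # v" using reduced_Cons_iff[OF r] by blast
    have c: "adj (res a b) a" using ab adj_res adj_sym by blast
    then have ne: "res a b \<noteq> bar a" using bar_not_adj adj_sym by metis
    obtain s where "w \<asymp> res (res a b) (bar a) # s" using v ne by (rule sim_Cons_lcm) blast
    moreover have "res (res a b) (bar a) = bar (res b a)"
      using res_bar[OF c] res_res[of b a] ab adj_sym by metis
    ultimately show False using nd by simp
  qed
  have ba: "adj b a" using assms by (rule adj_sym)
  show ?thesis
  proof (cases rule: act_cases[OF w(2), of "res a b"])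
    case c: (1 v)
    show ?thesis
    proof (cases rule: act_cases[OF w(2), of "res b a"])
      case d: (1 v')
      have cd: "adj (res a b) (res b a)" using assms by (rule adj_res_res)
      have "bar (res a b) # v \<asymp> bar (res b a) # v'" using c d sim_trans sim_sym by blast
      moreover have "bar (res a b) \<noteq> bar (res b a)" using cd adj_irrefl bar_bar by metis
      ultimately obtain s where s: "v \<asymp> res (bar (res a b)) (bar (res b a)) # s"
        "v' \<asymp> res (bar (res b a)) (bar (res a b)) # s"
        by (rule sim_Cons_lcm)
      then have "act a (cls v) = cls s" "act b (cls v') = cls s"
        using act_cancel c d res_bar_corner(2) assms ba by simp_all
      then show ?thesis using c d w by simp
    next
      case d: 2
      then show ?thesis using mixed[OF assms] c w by simp
    qed
  next
    case c: 2
    show ?thesis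
    proof (cases rule: act_cases[OF w(2), of "res b a"])
      case d: (1 v)
      then show ?thesis using mixed[OF ba] c w by simp
    next
      case d: 2
      have "reduced (a # res a b # w)" "reduced (b # res b a # w)"
        using no_inverse[OF assms] no_inverse[OF ba] c d by blast+
      then show ?thesis using c d w act_Cons cls_eq_iff sim_swap[OF assms] by simp
    qed
  qed
qed

lemma foldr_act_sim: "w \<asymp> w' \<Longrightarrow> foldr act w = foldr act w'"
proof (induction rule: sim_induct)
  case (swap a b u v)
  show ?case using act_act_res[OF swap] by (simp add: fun_eq_iff)
qed simp_all

lemma act_bij: "bij (act a)"
  using act_inverse[of a] act_inverse[of "bar a"] by (intro o_bij[of "act (bar a)"]) (auto simp: fun_eq_iff)

lemma foldr_act_bij: "bij (foldr act w)"
proof (induction w)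
  case (Cons a w)
  then show ?case using bij_comp[OF Cons act_bij[of a]] by (simp add: comp_def)
qed (simp add: id_def[symmetric])

lemma foldr_act_reduced: "reduced w \<Longrightarrow> foldr act w (cls []) = cls w"
proof (induction w)
  case (Cons a w)
  then show ?case using act_Cons[OF Cons.prems] reduced_ConsD by simp
qed simp

end

section \<open>Values of words in a group\<close>

definition word_value :: "('b, 'c) monoid_scheme \<Rightarrow> ('a \<Rightarrow> 'b) \<Rightarrow> 'a list \<Rightarrow> 'b" where
  "word_value H g w = foldr (\<lambda>a y. g a \<otimes>\<^bsub>H\<^esub> y) w \<one>\<^bsub>H\<^esub>"

lemma word_value_simps [simp]:
  "word_value H g [] = \<one>\<^bsub>H\<^esub>"
  "word_value H g (a # w) = g a \<otimes>\<^bsub>H\<^esub> word_value H g w"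
  by (simp_all add: word_value_def)

text \<open>A map from a set \<open>U\<close> of letters to a group that respects formal inverses and the defining moves.  The
closure of \<open>U\<close> confines moves and cancellations to words over \<open>U\<close>, so relations among letters of \<open>U\<close>
determine the values of these words.\<close>

locale evaluated_alphabet = signed_alphabet + group H for H (structure) +
  fixes U :: "'a set" and g :: "'a \<Rightarrow> 'b"
  assumes bar_closed: "a \<in> U \<Longrightarrow> bar a \<in> U"
    and res_closed: "\<lbrakk>a \<in> U; b \<in> U; adj a b\<rbrakk> \<Longrightarrow> res a b \<in> U"
    and g_closed: "a \<in> U \<Longrightarrow> g a \<in> carrier H"
    and g_bar: "a \<in> U \<Longrightarrow> g (bar a) = inv (g a)"
    and g_swap: "\<lbrakk>a \<in> U; b \<in> U; adj a b\<rbrakk> \<Longrightarrow> g a \<otimes> g (res a b) = g b \<otimes> g (res b a)"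
begin

abbreviation val :: "'a list \<Rightarrow> 'b" where
  "val \<equiv> word_value H g"

lemma val_closed: "w \<in> lists U \<Longrightarrow> val w \<in> carrier H"
  by (induction w rule: lists.induct) (simp_all add: g_closed)

lemma val_append: "u \<in> lists U \<Longrightarrow> v \<in> lists U \<Longrightarrow> val (u @ v) = val u \<otimes> val v"
  by (induction u rule: lists.induct) (simp_all add: g_closed val_closed m_assoc)

text \<open>A move between words cannot leave \<open>U\<close>, because \<open>b\<close> is recovered from \<open>a\<close> and \<^term>\<open>res a b\<close> by
complementing with the inverse of \<open>a\<close>.\<close>

lemma sim_lists_val:
  "w \<asymp> w' \<Longrightarrow> (w \<in> lists U \<longleftrightarrow> w' \<in> lists U) \<and> (w \<in> lists U \<longrightarrow> val w = val w')"
proof (induction rule: sim_induct)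
  case (swap a b u v)
  have closed: "b \<in> U \<and> res b a \<in> U" if "adj a b" "a \<in> U" "res a b \<in> U" for a b
  proof -
    have "res (bar a) (res a b) \<in> U"
      by (rule res_closed[OF bar_closed[OF that(2)] that(3) bar_adj[OF adj_res[OF that(1)]]])
    then have "b \<in> U" using res_bar_res that(1) by metis
    then show ?thesis using that adj_sym res_closed by metis
  qed
  have "a \<in> U \<and> res a b \<in> U \<longleftrightarrow> b \<in> U \<and> res b a \<in> U"
    using closed swap adj_sym by blast
  moreover have "g a \<otimes> (g (res a b) \<otimes> val v) = g b \<otimes> (g (res b a) \<otimes> val v)"
    if "a \<in> U" "b \<in> U" "res a b \<in> U" "res b a \<in> U" "v \<in> lists U"
    using that g_swap[OF _ _ swap] by (simp add: m_assoc[symmetric] g_closed val_closed)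
  moreover have "val (u @ a # res a b # v) = val u \<otimes> (g a \<otimes> (g (res a b) \<otimes> val v))"
    if "u \<in> lists U" "v \<in> lists U" "a \<in> U" "res a b \<in> U"
    using that val_append[of u "a # res a b # v"] by simp
  moreover have "val (u @ b # res b a # v) = val u \<otimes> (g b \<otimes> (g (res b a) \<otimes> val v))"
    if "u \<in> lists U" "v \<in> lists U" "b \<in> U" "res b a \<in> U"
    using that val_append[of u "b # res b a # v"] by simp
  ultimately show ?case by (metis append_in_lists_conv Cons_in_lists_iff)
qed auto

lemma sim_lists: "w \<asymp> w' \<Longrightarrow> w \<in> lists U \<Longrightarrow> w' \<in> lists U"
  and sim_val: "w \<asymp> w' \<Longrightarrow> w \<in> lists U \<Longrightarrow> val w = val w'"
  using sim_lists_val by blast+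

text \<open>Reducing a word over \<open>U\<close> uses letters of \<open>U\<close> only and does not change its value in any group in which
the relations over \<open>U\<close> hold.\<close>

lemma reduced_form:
  assumes "w \<in> lists U"
  obtains r where "r \<in> lists U" "reduced r" "foldr act w (cls []) = cls r" "val w = val r"
  using assms
proof (induction w arbitrary: thesis rule: lists.induct)
  case Nil
  then show ?case using reduced_Nil by force
next
  case (Cons a w)
  obtain r where r: "r \<in> lists U" "reduced r" "foldr act w (cls []) = cls r" "val w = val r"
    using Cons.IH .
  show ?case
  proof (cases rule: act_cases[OF r(2), of a])
    case (1 v)
    have v: "bar a # v \<in> lists U" using sim_lists[OF 1(1) r(1)] .
    have "val (a # w) = g a \<otimes> (g (bar a) \<otimes> val v)"
      using r(4) sim_val[OF 1(1) r(1)] by simp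
    also have "\<dots> = val v" 
      using v Cons(1) g_bar by (simp add: m_assoc[symmetric] g_closed val_closed)
    finally show ?thesis using Cons.prems[of v] 1 r v by simp
  next
    case 2
    then show ?thesis using Cons.prems[of "a # r"] r Cons(1) by simp
  qed
qed

lemma val_bar_rev: "w \<in> lists U \<Longrightarrow> val (map bar (rev w)) = inv (val w)"
proof (induction w rule: lists.induct)
  case (Cons a w)
  have "map bar (rev w) \<in> lists U" using Cons(2) bar_closed by auto
  then show ?case
    using Cons val_append[of "map bar (rev w)" "[bar a]"] bar_closed
    by (simp add: g_bar g_closed val_closed inv_mult_group)
qed simp

end

section \<open>Signed letters of a trickle graph\<close>

context trickle_graph
begin

lemma edge_vertices:
  assumes "{x, y} \<in> E"
  shows "x \<in> V" "y \<in> V" "x \<noteq> y"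
  using graph assms unfolding simplicial_graph_def by (fastforce simp: doubleton_eq_iff)+

lemma edge_commute: "{x, y} \<in> E \<Longrightarrow> {y, x} \<in> E"
  by (simp add: insert_commute)

lemma star_iff: "y \<in> star E x \<longleftrightarrow> y = x \<or> {x, y} \<in> E"
  by (simp add: star_def)

lemma leq_antisym: "\<lbrakk>x \<in> V; y \<in> V; x \<preceq> y; y \<preceq> x\<rbrakk> \<Longrightarrow> x = y"
  using order unfolding partial_order_on_def antisym_def by auto

lemma leq_trans: "\<lbrakk>x \<in> V; y \<in> V; z \<in> V; x \<preceq> y; y \<preceq> z\<rbrakk> \<Longrightarrow> x \<preceq> z"
  using order unfolding partial_order_on_def preorder_on_def trans_def by blast

lemma star_V: "x \<in> V \<Longrightarrow> y \<in> star E x \<Longrightarrow> y \<in> V"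
  using edge_vertices by (auto simp: star_iff)

text \<open>The value \<^term>\<open>True\<close> stands for exponent \<open>1\<close>.  The monoid relation \<open>x y' = y x\<close> for \<open>y < x\<close> has
\<open>y' = \<phi>\<^sub>x\<^sup>-\<^sup>1(y)\<close>, which is why the positive sign goes with the inverse permutation.\<close>

definition turn :: "bool \<Rightarrow> 'v \<Rightarrow> 'v \<Rightarrow> 'v" where
  "turn e x = (if e then inv_into (star E x) (\<phi> x) else \<phi> x)"

lemma turn_bij: "x \<in> V \<Longrightarrow> bij_betw (turn e x) (star E x) (star E x)"
  using automorphism unfolding turn_def graph_automorphism_on_def
  by (auto intro: bij_betw_inv_into)

lemma turn_star: "x \<in> V \<Longrightarrow> y \<in> star E x \<Longrightarrow> turn e x y \<in> star E x"
  using turn_bij bij_betwE by fast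

lemma turn_turn: "x \<in> V \<Longrightarrow> y \<in> star E x \<Longrightarrow> turn e x (turn (\<not> e) x y) = y"
  using automorphism[of x] unfolding turn_def graph_automorphism_on_def
  by (auto simp: bij_betw_inv_into_left bij_betw_inv_into_right)

lemma turn_inj: "\<lbrakk>x \<in> V; y \<in> star E x; z \<in> star E x; turn e x y = turn e x z\<rbrakk> \<Longrightarrow> y = z"
  using turn_bij unfolding bij_betw_def inj_on_def by blast

lemma turn_edge_iff:
  assumes "x \<in> V" "y \<in> star E x" "z \<in> star E x"
  shows "{turn e x y, turn e x z} \<in> E \<longleftrightarrow> {y, z} \<in> E"
proof -
  have *: "{turn False x y, turn False x z} \<in> E \<longleftrightarrow> {y, z} \<in> E"
    if "y \<in> star E x" "z \<in> star E x" for y z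
    using automorphism[OF assms(1)] that unfolding graph_automorphism_on_def turn_def by simp
  show ?thesis
  proof (cases e)
    case True
    then show ?thesis
      using *[of "turn True x y" "turn True x z"] turn_star turn_turn[of x _ False] assms by simp
  qed (use * assms in simp)
qed

lemma turn_leq_iff:
  assumes "x \<in> V" "y \<in> star E x" "z \<in> star E x"
  shows "turn e x z \<preceq> turn e x y \<longleftrightarrow> z \<preceq> y"
proof -
  have *: "turn False x z \<preceq> turn False x y \<longleftrightarrow> z \<preceq> y"
    if "y \<in> star E x" "z \<in> star E x" for y z
    using \<phi>_le_iff[OF assms(1)] that unfolding turn_def by simp
  show ?thesis
  proof (cases e)
    case True
    then show ?thesis
      using *[of "turn True x y" "turn True x z"] turn_star turn_turn[of x _ False] assms by simp
  qed (use * assms in simp)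
qed

lemma turn_moves_below:
  assumes "x \<in> V" "y \<in> star E x" "turn e x y \<noteq> y"
  shows "y \<preceq> x \<and> y \<noteq> x"
proof (cases e)
  case True
  define z where "z = turn True x y"
  have z: "z \<in> star E x" "turn False x z = y"
    using assms turn_star turn_turn[of x y False] by (simp_all add: z_def)
  have x: "x \<in> star E x" "turn False x x = x"
    using \<phi>_moves_below[OF assms(1), of x] by (auto simp: star_iff turn_def)
  have "\<phi> x z \<noteq> z" using z(2) assms(3) True by (simp add: turn_def z_def)
  then have "z \<preceq> x" "z \<noteq> x" using \<phi>_moves_below[OF assms(1) z(1)] by auto
  then show ?thesis
    using turn_leq_iff[OF assms(1) x(1) z(1), of False] z(2) x turn_inj[OF assms(1) z(1) x(1)]
    by metis
next
  case False
  then show ?thesis using \<phi>_moves_below assms by (simp add: turn_def)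
qed

lemma turn_self: "x \<in> V \<Longrightarrow> turn e x x = x"
  using turn_moves_below[of x x] by (auto simp: star_iff)

lemma turn_edge: "{x, y} \<in> E \<Longrightarrow> {x, turn e x y} \<in> E"
  using turn_edge_iff[of x x y e] turn_self edge_vertices[of x y] by (simp add: star_iff)

text \<open>The axiom on nested pairs says that \<^term>\<open>\<phi> x\<close> conjugates \<^term>\<open>\<phi> y\<close> to \<^term>\<open>\<phi> (\<phi> x y)\<close> on the
vertices below.  The same then holds for the inverse of \<^term>\<open>\<phi> y\<close> (\<open>inner\<close>) and, by
transporting the identity along \<^term>\<open>\<phi> x\<close>, for the inverse of \<^term>\<open>\<phi> x\<close>.\<close>

lemma turn_turn_below:
  assumes V: "x \<in> V" "y \<in> V" "z \<in> V" and zy: "z \<preceq> y" "z \<noteq> y" and yx: "y \<preceq> x" "y \<noteq> x"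
  shows "turn d x (turn e y z) = turn e (turn d x y) (turn d x z)"
proof -
  have step: "turn False x (turn False y z) = turn False (turn False x y) (turn False x z)"
    if "x \<in> V" "y \<in> V" "z \<in> V" "z \<preceq> y" "z \<noteq> y" "y \<preceq> x" "y \<noteq> x" for x y z
    using \<phi>_\<phi> that by (simp add: turn_def)
  have star: "y \<in> star E x" "turn e x y \<in> V" "turn e x y \<preceq> x" "turn e x y \<noteq> x"
    if "x \<in> V" "y \<in> V" "y \<preceq> x" "y \<noteq> x" for x y e
  proof -
    show s: "y \<in> star E x" using that less_adjacent edge_commute by (simp add: star_iff)
    show "turn e x y \<in> V" using that s turn_star star_V by blast
    have x: "x \<in> star E x" by (simp add: star_iff)
    show "turn e x y \<preceq> x" using turn_leq_iff[OF that(1) x s, of e] turn_self that by simp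
    show "turn e x y \<noteq> x" using turn_inj[OF that(1) s x, of e] turn_self that by metis
  qed
  have below: "z \<preceq> x" "z \<noteq> x"
    if "x \<in> V" "y \<in> V" "z \<in> V" "z \<preceq> y" "z \<noteq> y" "y \<preceq> x" "y \<noteq> x" for x y z
    using that leq_trans leq_antisym by blast+
  have inner: "turn False x (turn e y z) = turn e (turn False x y) (turn False x z)"
    if v: "x \<in> V" "y \<in> V" "z \<in> V" and l: "z \<preceq> y" "z \<noteq> y" "y \<preceq> x" "y \<noteq> x" for x y z
  proof (cases e)
    case True
    let ?w = "turn True y z"
    have w: "?w \<in> V" "?w \<preceq> y" "?w \<noteq> y" "turn False y ?w = z"
      using star[OF v(2,3) l(1,2)] turn_turn[of y z False] v by auto
    have "turn False x z = turn False (turn False x y) (turn False x ?w)"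
      using step[OF v(1,2) w(1-3) l(3,4)] w(4) by simp
    moreover have "turn False x ?w \<in> star E (turn False x y)"
      using turn_edge_iff[of x y ?w False] star[OF v(1,2) l(3,4)] star(1)[OF v(1) w(1)]
        below[OF v(1,2) w(1-3) l(3,4)] less_adjacent[OF w(1) v(2) w(2,3)] v edge_commute
      by (simp add: star_iff)
    ultimately show ?thesis
      using turn_turn[of "turn False x y" "turn False x ?w" True] star[OF v(1,2) l(3,4)] True by simp
  qed (use step that in simp)
  show ?thesis
  proof (cases d)
    case True
    let ?y = "turn True x y" and ?z = "turn True x z"
    have zx: "z \<preceq> x" "z \<noteq> x" using below[OF V zy yx] by auto
    note y = star(1)[OF V(1,2) yx] star(2,3,4)[OF V(1,2) yx, of True]
      and z = star(1)[OF V(1,3) zx] star(2,3,4)[OF V(1,3) zx, of True]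
    have undo: "turn False x ?y = y" "turn False x ?z = z"
      using turn_turn[of x _ False] V(1) y(1) z(1) by simp_all
    have lt: "?z \<preceq> ?y" "?z \<noteq> ?y"
      using turn_leq_iff[OF V(1) y(1) z(1)] turn_inj[OF V(1) z(1) y(1)] zy by auto
    note w = star(2,3,4)[OF y(2) z(2) lt, of e]
    have "turn e ?y ?z \<in> star E x"
      using star(1)[OF V(1) w(1)] below[OF V(1) y(2) w y(3,4)] by blast
    then have "turn True x (turn False x (turn e ?y ?z)) = turn e ?y ?z"
      using turn_turn[of x _ True] V(1) by simp
    then show ?thesis
      using inner[OF V(1) y(2) z(2) lt y(3,4)] undo True by simp
  qed (use inner assms in simp)
qed

text \<open>A signed letter is a vertex with an exponent.  The two letters over one vertex are not adjacent,
since the graph has no loops.\<close>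

definition ladj :: "'v \<times> bool \<Rightarrow> 'v \<times> bool \<Rightarrow> bool" where
  "ladj a b \<longleftrightarrow> {fst a, fst b} \<in> E"

definition lres :: "'v \<times> bool \<Rightarrow> 'v \<times> bool \<Rightarrow> 'v \<times> bool" where
  "lres a b = (turn (snd a) (fst a) (fst b), snd b)"

definition lbar :: "'v \<times> bool \<Rightarrow> 'v \<times> bool" where
  "lbar a = (fst a, \<not> snd a)"

lemma turn_fixes_above:
  assumes "{x, y} \<in> E" "\<not> y \<preceq> x"
  shows "turn e x y = y"
  using turn_moves_below[of x y e] assms edge_vertices by (auto simp: star_iff)

text \<open>If \<open>y < x\<close>, this is \<open>turn_turn_below\<close> when also \<open>z < y\<close>; otherwise \<open>y\<close> does not move \<open>z\<close>, and the image
of \<open>y\<close> under turning by \<open>x\<close> does not move the image of \<open>z\<close>.  If \<open>x\<close> and \<open>y\<close> are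
incomparable, they do not move each other, and \<open>z\<close> cannot lie below both, since everything below \<open>y\<close> is incomparable with \<open>x\<close>; so at most one of the two
vertices moves \<open>z\<close>, and the image of \<open>z\<close>, being below that vertex too, is fixed by the other one.\<close>

lemma turn_cube:
  assumes xy: "{x, y} \<in> E" and yz: "{y, z} \<in> E" and xz: "{x, z} \<in> E"
  shows "turn e (turn d x y) (turn d x z) = turn d (turn e y x) (turn e y z)"
proof -
  have incomparable: "turn e y (turn d x z) = turn d x (turn e y z)"
    if xy: "{x, y} \<in> E" and yz: "{y, z} \<in> E" and xz: "{x, z} \<in> E"
      and nx: "\<not> x \<preceq> y" "\<not> y \<preceq> x" and z: "\<not> z \<preceq> y" for x y z d e
  proof -
    have 1: "turn e y z = z" using turn_fixes_above[OF yz z] .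
    show ?thesis
    proof (cases "z \<preceq> x")
      case True
      have "turn d x z \<preceq> x"
        using turn_leq_iff[of x x z d] True turn_self edge_vertices[OF xz] xz by (simp add: star_iff)
      then have "{y, turn d x z} \<in> E \<and> \<not> turn d x z \<preceq> y"
        using parallel_below[of y x "turn d x z"] xy nx edge_vertices[OF xy] edge_commute
          edge_vertices[OF turn_edge[OF xz]] by blast
      then show ?thesis using 1 turn_fixes_above by simp
    next
      case False
      then show ?thesis using 1 turn_fixes_above xz by simp
    qed
  qed
  have below: "turn e (turn d x y) (turn d x z) = turn d x (turn e y z)"
    if xy: "{x, y} \<in> E" and yz: "{y, z} \<in> E" and xz: "{x, z} \<in> E" and yx: "y \<preceq> x" for x y z d e
  proof (cases "z \<preceq> y")
    case True
    then show ?thesis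
      using turn_turn_below[of x y z d e] edge_vertices[OF xy] edge_vertices[OF yz] yx by simp
  next
    case False
    have "{turn d x y, turn d x z} \<in> E" "\<not> turn d x z \<preceq> turn d x y"
      using turn_edge_iff[of x y z d] turn_leq_iff[of x y z d] False assms that
        edge_vertices[OF xy] by (simp_all add: star_iff)
    then show ?thesis using turn_fixes_above[OF yz False] turn_fixes_above by simp
  qed
  consider "y \<preceq> x" | "x \<preceq> y" | "\<not> x \<preceq> y" "\<not> y \<preceq> x" by blast
  then show ?thesis
  proof cases
    case 1
    then have "turn e y x = x"
      using turn_fixes_above[of y x] xy leq_antisym edge_vertices[OF xy] edge_commute by metis
    then show ?thesis using below[OF xy yz xz 1] by simp
  next
    case 2
    then have "turn d x y = y"
      using turn_fixes_above[of x y] xy leq_antisym edge_vertices[OF xy] by metis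
    then show ?thesis using below[OF edge_commute[OF xy] xz yz 2] by simp
  next
    case 3
    then have "turn d x y = y" "turn e y x = x"
      using turn_fixes_above xy edge_commute by blast+
    moreover have "\<not> z \<preceq> y \<or> \<not> z \<preceq> x"
      using parallel_below[of x y z] 3 xy edge_vertices[OF xy] edge_vertices[OF xz] by blast
    ultimately show ?thesis
      using incomparable[OF xy yz xz] incomparable[OF edge_commute[OF xy] xz yz] 3 by metis
  qed
qed

text \<open>If \<open>y\<close> moves \<open>x\<close>, then \<open>x\<close> and its turned copy lie below \<open>y\<close>, and neither of them moves \<open>y\<close>.\<close>

lemma turn_by_turned:
  assumes "{x, y} \<in> E"
  shows "turn d (turn e y x) y = turn d x y"
proof (cases "turn e y x = x")
  case False
  have V: "x \<in> V" "y \<in> V" "x \<noteq> y" and s: "x \<in> star E y" "y \<in> star E y"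
    using edge_vertices[OF assms] assms edge_commute by (auto simp: star_iff)
  have "x \<preceq> y" using turn_moves_below[OF V(2) s(1) False] by blast
  then have "turn e y x \<preceq> y" using turn_leq_iff[OF V(2) s(2,1)] turn_self[OF V(2)] by simp
  moreover have e: "{y, turn e y x} \<in> E" using turn_edge[OF edge_commute[OF assms]] .
  ultimately have "\<not> y \<preceq> turn e y x" using leq_antisym edge_vertices by metis
  moreover have "\<not> y \<preceq> x" using \<open>x \<preceq> y\<close> leq_antisym V by blast
  ultimately show ?thesis using turn_fixes_above e assms edge_commute by metis
qed simp

sublocale signed_alphabet ladj lres lbar
proof
  show "ladj a b \<Longrightarrow> ladj b a" for a b
    by (simp add: ladj_def edge_commute)
  show "\<not> ladj a a" for a
    using edge_vertices(3)[of "fst a" "fst a"] by (auto simp: ladj_def)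
  show "ladj (lres c a) (lres c b) \<longleftrightarrow> ladj a b" if "ladj c a" "ladj c b" for a b c
    using that turn_edge_iff edge_vertices by (auto simp: ladj_def lres_def star_iff)
  show "a = b" if "ladj c a" "ladj c b" "lres c a = lres c b" for a b c
    using that turn_inj[of "fst c" "fst a" "fst b"] edge_vertices
    by (auto simp: ladj_def lres_def star_iff prod_eq_iff)
  show "lres (lres a b) (lres a c) = lres (lres b a) (lres b c)"
    if "ladj a b" "ladj b c" "ladj a c" for a b c
    using that turn_cube by (simp add: ladj_def lres_def)
  show "lbar (lbar a) = a" for a
    by (simp add: lbar_def)
  show "ladj a b \<Longrightarrow> ladj (lbar a) b" for a b
    by (simp add: ladj_def lbar_def)
  show "ladj a b \<Longrightarrow> lres a (lbar b) = lbar (lres a b)" for a b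
    by (simp add: lres_def lbar_def)
  show "lres (lbar a) (lres a b) = b" if "ladj a b" for a b
    using that turn_turn[of "fst a" "fst b" "\<not> snd a"] edge_vertices
    by (auto simp: ladj_def lres_def lbar_def star_iff prod_eq_iff)
  show "lres (lres b a) b = lres a b" if "ladj a b" for a b
    using that turn_by_turned by (simp add: ladj_def lres_def)
  show "ladj a (lres a b)" if "ladj a b" for a b
    using that turn_edge by (simp add: ladj_def lres_def)
qed

end

section \<open>Words and joins in the trickle monoid\<close>

context trickle_graph
begin

notation sim (infix "\<asymp>" 50)

abbreviation "M \<equiv> trickle_monoid V E \<phi>"

definition relators :: "('v list \<times> 'v list) set" where
  "relators = {([\<phi> x y, x], [\<phi> y x, y]) | x y. {x, y} \<in> E}"

definition mclass :: "'v list \<Rightarrow> 'v list set" where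
  "mclass w = presentation_cong V relators `` {w}"

definition positive :: "'v list \<Rightarrow> ('v \<times> bool) list" where
  "positive w = map (\<lambda>x. (x, True)) w"

lemma pos_simps [simp]: "positive [] = []" "positive (x # w) = (x, True) # positive w" "positive (u @ v) = positive u @ positive v"
  by (simp_all add: positive_def)

lemma relators_subset: "relators \<subseteq> lists V \<times> lists V"
  unfolding relators_def by (rule trickle_relators_subset[OF trickle_graph_axioms])

lemma monoid_M: "monoid M"
  by (rule trickle_monoid_is_monoid[OF trickle_graph_axioms])

lemma M_eq: "M = presented_monoid V relators"
  by (simp add: trickle_monoid_def relators_def)

lemma carrier_M: "carrier M = mclass ` lists V"
  by (auto simp: M_eq presented_monoid_def quotient_def mclass_def)

lemma carrier_M_E:
  assumes "a \<in> carrier M"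
  obtains u where "u \<in> lists V" "a = mclass u"
  using assms unfolding carrier_M by (metis imageE)

lemma one_M: "\<one>\<^bsub>M\<^esub> = mclass []"
  by (simp add: M_eq presented_monoid_def mclass_def)

lemma mult_M: "u \<in> lists V \<Longrightarrow> v \<in> lists V \<Longrightarrow> mclass u \<otimes>\<^bsub>M\<^esub> mclass v = mclass (u @ v)"
  unfolding M_eq mclass_def by (rule presented_monoid_mult[OF relators_subset])

lemma mclass_eq_iff_cong:
  "u \<in> lists V \<Longrightarrow> v \<in> lists V \<Longrightarrow> mclass u = mclass v \<longleftrightarrow> (u, v) \<in> presentation_cong V relators"
  unfolding mclass_def by (rule eq_equiv_class_iff[OF presentation_cong_equiv[OF relators_subset]])

text \<open>The relators are indexed by the second letters of the two words, the moves by the first ones.  The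
corner identity \<open>res_bar_corner\<close> recovers either pair from the other.\<close>

lemma relators_are_swaps:
  "relators = {([x, turn True x y], [y, turn True y x]) | x y. {x, y} \<in> E}"
proof -
  have corner: "turn (\<not> e) (turn e x y) (turn e y x) = x" "{turn e x y, turn e y x} \<in> E"
    if "{x, y} \<in> E" for e x y
    using res_bar_corner(1)[of "(x, e)" "(y, e)"] adj_res_res[of "(x, e)" "(y, e)"] that
    by (simp_all add: ladj_def lres_def lbar_def)
  have "\<exists>a b. \<phi> x y = a \<and> x = turn True a b \<and> \<phi> y x = b \<and> y = turn True b a \<and> {a, b} \<in> E"
    if "{x, y} \<in> E" for x y
    using corner[of x y False] corner[of y x False] that edge_commute[OF that]
    by (simp add: turn_def[of False])
  moreover have "\<exists>a b. x = \<phi> a b \<and> turn True x y = a \<and> y = \<phi> b a \<and> turn True y x = b \<and> {a, b} \<in> E"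
    if "{x, y} \<in> E" for x y
    using corner[of x y True] corner[of y x True] that edge_commute[OF that]
    by (simp add: turn_def[of False])
  ultimately show ?thesis unfolding relators_def by blast
qed

lemma cong_pos_sim: "(w, w') \<in> presentation_cong V relators \<Longrightarrow> positive w \<asymp> positive w'"
proof (induction rule: presentation_cong.induct)
  case (relator l r u v)
  then obtain x y where xy: "{x, y} \<in> E" "l = [x, turn True x y]" "r = [y, turn True y x]"
    unfolding relators_are_swaps by blast
  have "positive (l @ v) \<asymp> positive (r @ v)"
    using sim_swap[of "(x, True)" "(y, True)" "positive v"] xy by (simp add: ladj_def lres_def)
  then show ?case using sim_append[OF sim_refl] by simp
qed (auto intro: sim_sym sim_trans)

text \<open>Moves keep the exponents, so on positive words the equivalence of signed words is no coarser than
the congruence that defines the monoid.\<close>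

lemma sim_positive:
  "s \<asymp> t \<Longrightarrow> (s \<in> lists (V \<times> {True}) \<longleftrightarrow> t \<in> lists (V \<times> {True})) \<and>
     (s \<in> lists (V \<times> {True}) \<longrightarrow> (map fst s, map fst t) \<in> presentation_cong V relators)"
proof (induction rule: sim_induct)
  case (swap a b u v)
  then have e: "{fst a, fst b} \<in> E" by (simp add: ladj_def)
  have 1: "a \<in> V \<times> {True} \<and> lres a b \<in> V \<times> {True} \<longleftrightarrow> snd a \<and> snd b"
    if "{fst a, fst b} \<in> E" for a b
    using edge_vertices[OF that] edge_vertices[OF turn_edge[OF that, of "snd a"]]
    by (auto simp: lres_def mem_Times_iff)
  have "(map fst u @ [fst a, turn True (fst a) (fst b)] @ map fst v,
         map fst u @ [fst b, turn True (fst b) (fst a)] @ map fst v) \<in> presentation_cong V relators"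
    if "u \<in> lists (V \<times> {True})" "v \<in> lists (V \<times> {True})"
  proof (rule presentation_cong.relator)
    show "([fst a, turn True (fst a) (fst b)], [fst b, turn True (fst b) (fst a)]) \<in> relators"
      using e unfolding relators_are_swaps by blast
    show "map fst u \<in> lists V" "map fst v \<in> lists V" using that by (fastforce simp: mem_Times_iff)+
  qed
  moreover have "u @ a # lres a b # v \<in> lists (V \<times> {True}) \<longleftrightarrow>
      u \<in> lists (V \<times> {True}) \<and> v \<in> lists (V \<times> {True}) \<and> snd a \<and> snd b"
    using 1[OF e] unfolding append_in_lists_conv Cons_in_lists_iff by argo
  moreover have "u @ b # lres b a # v \<in> lists (V \<times> {True}) \<longleftrightarrow>
      u \<in> lists (V \<times> {True}) \<and> v \<in> lists (V \<times> {True}) \<and> snd a \<and> snd b"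
    using 1[OF edge_commute[OF e]] unfolding append_in_lists_conv Cons_in_lists_iff by argo
  ultimately show ?case by (simp only: map_append list.map) (simp add: lres_def)
next
  case (refl w)
  have "map fst w \<in> lists V" if "w \<in> lists (V \<times> {True})"
    using that by (fastforce simp: mem_Times_iff)
  then show ?case by (blast intro: presentation_cong.refl)
next
  case (sym w w')
  then show ?case by (blast intro: presentation_cong.sym)
next
  case (trans w w' w'')
  then show ?case by (blast intro: presentation_cong.trans)
qed

lemma pos_lists: "positive w \<in> lists (U \<times> {True}) \<longleftrightarrow> w \<in> lists U"
  by (induction w) auto

lemma map_fst_pos [simp]: "map fst (positive w) = w"
  by (simp add: positive_def comp_def)

lemma pos_map_fst: "s \<in> lists (V \<times> {True}) \<Longrightarrow> positive (map fst s) = s"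
  by (induction s rule: lists.induct) auto

lemma mclass_eq_iff: "u \<in> lists V \<Longrightarrow> v \<in> lists V \<Longrightarrow> mclass u = mclass v \<longleftrightarrow> positive u \<asymp> positive v"
  using mclass_eq_iff_cong cong_pos_sim sim_positive[of "positive u" "positive v"] pos_lists by auto

lemma pos_sim_pos:
  assumes "positive w \<asymp> s" "w \<in> lists V"
  obtains v where "v \<in> lists V" "s = positive v"
proof -
  have s: "s \<in> lists (V \<times> {True})" using sim_positive[OF assms(1)] assms(2) pos_lists by blast
  show ?thesis
    using that[of "map fst s"] pos_map_fst[OF s] s pos_lists[of "map fst s" V] by simp
qed

lemma reduced_pos:
  assumes "w \<in> lists V"
  shows "reduced (positive w)"
proof -
  have False if sim: "positive w \<asymp> u @ a # lbar a # v" for u a v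
  proof -
    obtain w' where "u @ a # lbar a # v = positive w'" using pos_sim_pos[OF sim assms] by blast
    then have "a \<in> set (positive w')" "lbar a \<in> set (positive w')" by (metis in_set_conv_decomp append_Cons append_assoc append_Nil)+
    then show False by (auto simp: positive_def lbar_def)
  qed
  then show ?thesis unfolding reduced_def by blast
qed

lemma le_L_mclass:
  "x \<in> lists V \<Longrightarrow> le_L M (mclass x) d \<longleftrightarrow> (\<exists>p\<in>lists V. d = mclass (x @ p))"
  unfolding le_L_def carrier_M by (auto simp: mult_M)

lemma le_R_mclass:
  "x \<in> lists V \<Longrightarrow> le_R M (mclass x) d \<longleftrightarrow> (\<exists>p\<in>lists V. d = mclass (p @ x))"
  unfolding le_R_def carrier_M by (auto simp: mult_M)

lemma le_L_mclassI: "x \<in> lists V \<Longrightarrow> p \<in> lists V \<Longrightarrow> le_L M (mclass x) (mclass (x @ p))"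
  using le_L_mclass by blast

lemma le_R_mclassI: "x \<in> lists V \<Longrightarrow> p \<in> lists V \<Longrightarrow> le_R M (mclass x) (mclass (p @ x))"
  using le_R_mclass by blast

text \<open>Together with \<open>join_R_of_edge\<close> this forces the vertex set of a parabolic submonoid to be stable under
turning: the join for left divisibility uses the inverse of \<^term>\<open>\<phi> x\<close>, that for right
divisibility \<^term>\<open>\<phi> x\<close> itself.\<close>

lemma join_L_of_edge:
  assumes "{x, y} \<in> E"
  shows "is_join M (le_L M) (mclass [x]) (mclass [y]) (mclass [x, turn True x y])"
proof -
  have V: "x \<in> V" "y \<in> V" "x \<noteq> y" "turn True x y \<in> V" "turn True y x \<in> V"
    using edge_vertices assms turn_edge edge_commute by blast+
  have "positive [x, turn True x y] \<asymp> positive [y, turn True y x]"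
    using sim_swap[of "(x, True)" "(y, True)" "[]"] assms by (simp add: ladj_def lres_def)
  then have eq: "mclass [x, turn True x y] = mclass [y, turn True y x]" using mclass_eq_iff V by simp
  have "le_L M (mclass [x, turn True x y]) d" if "le_L M (mclass [x]) d" "le_L M (mclass [y]) d" for d
  proof -
    obtain p q where p: "p \<in> lists V" "d = mclass ([x] @ p)" and q: "q \<in> lists V" "d = mclass ([y] @ q)"
      using \<open>le_L M (mclass [x]) d\<close> \<open>le_L M (mclass [y]) d\<close>
        le_L_mclass[of "[x]" d] le_L_mclass[of "[y]" d] V by (simp only: Cons_in_lists_iff lists.Nil) blast
    have "(x, True) # positive p \<asymp> (y, True) # positive q"
      using mclass_eq_iff[of "x # p" "y # q"] p q V by simp
    then obtain u where u: "positive p \<asymp> lres (x, True) (y, True) # u"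
      by (rule sim_Cons_lcm) (use V in auto)
    then obtain v where v: "v \<in> lists V" "lres (x, True) (y, True) # u = positive v"
      using pos_sim_pos p by blast
    then obtain v' where "v = turn True x y # v'" by (cases v) (auto simp: lres_def)
    then have "d = mclass (x # turn True x y # v')" "v' \<in> lists V"
      using mclass_eq_iff[of "x # p" "x # v"] u v p V sim_Cons by auto
    then show ?thesis using le_L_mclassI[of "[x, turn True x y]" v'] V by simp
  qed
  moreover have "le_L M (mclass [x]) (mclass [x, turn True x y])" "le_L M (mclass [y]) (mclass [x, turn True x y])"
    using le_L_mclassI[of "[x]" "[turn True x y]"] le_L_mclassI[of "[y]" "[turn True y x]"] V eq by simp_all
  ultimately show ?thesis unfolding is_join_def carrier_M using V by auto
qed

lemma join_R_of_edge:
  assumes "{x, y} \<in> E"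
  shows "is_join M (le_R M) (mclass [x]) (mclass [y]) (mclass [turn False x y, x])"
proof -
  have V: "x \<in> V" "y \<in> V" "x \<noteq> y" "turn False x y \<in> V" "turn False y x \<in> V"
    using edge_vertices assms turn_edge edge_commute by blast+
  have "([turn False x y, x], [turn False y x, y]) \<in> relators"
    using assms by (auto simp: relators_def turn_def)
  from presentation_cong.relator[OF this, of "[]" V "[]"]
  have eq: "mclass [turn False x y, x] = mclass [turn False y x, y]" using mclass_eq_iff_cong V by simp
  have "le_R M (mclass [turn False x y, x]) d" if "le_R M (mclass [x]) d" "le_R M (mclass [y]) d" for d
  proof -
    obtain p q where p: "p \<in> lists V" "d = mclass (p @ [x])" and q: "q \<in> lists V" "d = mclass (q @ [y])"
      using \<open>le_R M (mclass [x]) d\<close> \<open>le_R M (mclass [y]) d\<close>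
        le_R_mclass[of "[x]" d] le_R_mclass[of "[y]" d] V by (simp only: Cons_in_lists_iff lists.Nil) blast
    have "positive p @ [(x, True)] \<asymp> positive q @ [(y, True)]"
      using mclass_eq_iff[of "p @ [x]" "q @ [y]"] p q V by simp
    then obtain u where "positive p \<asymp> u @ [lres (lbar (x, True)) (y, True)]"
      by (rule sim_snoc_lcm) (use V in auto)
    then have u: "positive p \<asymp> u @ [(turn False x y, True)]" by (simp add: lres_def lbar_def)
    then obtain v where v: "v \<in> lists V" "u @ [(turn False x y, True)] = positive v"
      using pos_sim_pos p by blast
    then obtain v' where "v = v' @ [turn False x y]" unfolding positive_def
      by (cases v rule: rev_cases) auto
    then have "d = mclass (v' @ [turn False x y, x])" "v' \<in> lists V"
      using mclass_eq_iff[of "p @ [x]" "v @ [x]"] sim_append[OF u sim_refl[of "[(x, True)]"]] v p V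
      by auto
    then show ?thesis using le_R_mclassI[of "[turn False x y, x]" v'] V by simp
  qed
  moreover have "le_R M (mclass [x]) (mclass [turn False x y, x])" "le_R M (mclass [y]) (mclass [turn False x y, x])"
    using le_R_mclassI[of "[x]" "[turn False x y]"] le_R_mclassI[of "[y]" "[turn False y x]"] V eq by simp_all
  ultimately show ?thesis unfolding is_join_def carrier_M using V by auto
qed

end

section \<open>Standard submonoids and their enveloping groups\<close>

text \<open>A set of vertices stable under turning, and the submonoid that it generates.  The parabolic
submonoids and the whole monoid arise in this way.\<close>

locale standard_submonoid = trickle_graph V E leq \<mu> \<phi>
  for V :: "'v set" and E and leq (infix "\<preceq>" 50) and \<mu> and \<phi> +
  fixes U :: "'v set"
  assumes U_subset: "U \<subseteq> V"
    and turn_closed: "\<lbrakk>x \<in> U; y \<in> U; {x, y} \<in> E\<rbrakk> \<Longrightarrow> turn e x y \<in> U"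

text \<open>Being special, \<^term>\<open>N\<close> contains an element exactly when it contains all letters of a word for it.
Being closed under joins, it contains the join of two adjacent vertices of \<^term>\<open>N\<close>, and then the
turned vertex, which is a factor of this join.\<close>

lemma (in trickle_graph) parabolic_standard:
  assumes "parabolic_submonoid N M"
  defines "U \<equiv> {x \<in> V. mclass [x] \<in> N}"
  shows "standard_submonoid V E leq \<mu> \<phi> U" and "N = mclass ` lists U"
proof -
  interpret N: submonoid N M
    using assms(1) unfolding parabolic_submonoid_def special_submonoid_def by blast
  have split: "mclass [x] \<in> N \<and> mclass w \<in> N" if "mclass (x # w) \<in> N" "x \<in> V" "w \<in> lists V" for x w
  proof -
    have "mclass [x] \<in> carrier M" "mclass w \<in> carrier M" using that by (auto simp: carrier_M)
    moreover have "mclass [x] \<otimes>\<^bsub>M\<^esub> mclass w \<in> N" using that mult_M[of "[x]" w] by simp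
    ultimately show ?thesis
      using assms(1) unfolding parabolic_submonoid_def special_submonoid_def by blast
  qed
  show "standard_submonoid V E leq \<mu> \<phi> U"
  proof unfold_locales
    show "U \<subseteq> V" by (auto simp: U_def)
    show "turn e x y \<in> U" if xy: "x \<in> U" "y \<in> U" "{x, y} \<in> E" for e x y
    proof -
      have V: "turn e x y \<in> V" "x \<in> V" using edge_vertices turn_edge xy(3) by blast+
      show ?thesis
      proof (cases e)
        case True
        have "mclass [x, turn True x y] \<in> N"
          using assms(1) join_L_of_edge[OF xy(3)] xy unfolding U_def parabolic_submonoid_def by blast
        then show ?thesis using split[of x "[turn e x y]"] V True by (simp add: U_def)
      next
        case False
        have "mclass [turn False x y, x] \<in> N"
          using assms(1) join_R_of_edge[OF xy(3)] xy unfolding U_def parabolic_submonoid_def by blast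
        then show ?thesis using split[of "turn e x y" "[x]"] V False by (simp add: U_def)
      qed
    qed
  qed
  have mem: "w \<in> lists V \<Longrightarrow> mclass w \<in> N \<longleftrightarrow> w \<in> lists U" for w
  proof (induction w)
    case Nil
    then show ?case using N.one_closed one_M by simp
  next
    case (Cons x w)
    have "mclass (x # w) \<in> N" if "mclass [x] \<in> N" "mclass w \<in> N"
      using N.m_closed[OF that] mult_M[of "[x]" w] Cons(2) by simp
    then show ?case using split[of x w] Cons by (auto simp: U_def)
  qed
  have U_V: "w \<in> lists V" if "w \<in> lists U" for w using that by (auto simp: U_def)
  show "N = mclass ` lists U"
  proof
    show "N \<subseteq> mclass ` lists U"
    proof
      fix n assume n: "n \<in> N"
      then obtain w where "w \<in> lists V" "n = mclass w" using N.subset carrier_M by blast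
      then show "n \<in> mclass ` lists U" using mem n by blast
    qed
    show "mclass ` lists U \<subseteq> N" using mem U_V by blast
  qed
qed

context trickle_graph
begin

definition signed_image :: "('g, 'm) monoid_scheme \<Rightarrow> ('v list set \<Rightarrow> 'g) \<Rightarrow> 'v \<times> bool \<Rightarrow> 'g" where
  "signed_image H k a = (if snd a then k (mclass [fst a]) else inv\<^bsub>H\<^esub> k (mclass [fst a]))"

definition M_value :: "('v \<times> bool) list \<Rightarrow> ('v list set + 'v list set) list set" where
  "M_value = word_value (enveloping_group M) (signed_image (enveloping_group M) (enveloping_hom M))"

end

context standard_submonoid
begin

definition N where "N = mclass ` lists U"

abbreviation "K \<equiv> M\<lparr>carrier := N\<rparr>"

lemma lists_U_V: "w \<in> lists U \<Longrightarrow> w \<in> lists V"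
  using U_subset by auto

lemma submonoid_N: "submonoid N M"
proof
  show "N \<subseteq> carrier M" using lists_U_V by (auto simp: N_def carrier_M)
  show "\<one>\<^bsub>M\<^esub> \<in> N" by (auto simp: N_def one_M)
  show "a \<otimes>\<^bsub>M\<^esub> b \<in> N" if ab: "a \<in> N" "b \<in> N" for a b
  proof -
    obtain u v where "u \<in> lists U" "v \<in> lists U" "a = mclass u" "b = mclass v"
      using ab unfolding N_def by blast
    then have "a \<otimes>\<^bsub>M\<^esub> b = mclass (u @ v)" "u @ v \<in> lists U" using mult_M lists_U_V by auto
    then show ?thesis unfolding N_def by blast
  qed
qed

lemma monoid_K: "monoid K"
  by (rule submonoid.submonoid_is_monoid[OF submonoid_N monoid_M])

lemma inclusion_hom: "(\<lambda>a. a) \<in> hom K M"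
  using submonoid.subset[OF submonoid_N] by (auto simp: hom_def)

lemma hom_K_mult:
  assumes "k \<in> hom K H" "u \<in> lists U" "v \<in> lists U"
  shows "k (mclass (u @ v)) = k (mclass u) \<otimes>\<^bsub>H\<^esub> k (mclass v)"
proof -
  have "mclass u \<in> carrier K" "mclass v \<in> carrier K" using assms by (auto simp: N_def)
  from hom_mult[OF assms(1) this] show ?thesis using mult_M[of u v] lists_U_V assms by simp
qed

text \<open>The relations among positive letters are the images of monoid relations.  The step \<open>flip\<close> derives the
relation for \<open>a\<close> and \<open>b\<^sup>-\<^sup>1\<close> from the one for \<open>a'\<close> and \<open>b\<close>, where \<open>a'\<close> is the complement of \<open>b\<^sup>-\<^sup>1\<close> in the
least common multiple of \<open>a\<close> and \<open>b\<^sup>-\<^sup>1\<close>, by moving \<open>b\<close> and its complement to the other sides; two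
applications, with symmetry, reach all combinations of signs.\<close>

lemma evaluated:
  assumes H: "group H" and k: "k \<in> hom K H"
  shows "evaluated_alphabet ladj lres lbar H (U \<times> UNIV) (signed_image H k)"
proof -
  interpret H: group H by fact
  let ?g = "signed_image H k"
  have k_closed: "k (mclass [x]) \<in> carrier H" if "x \<in> U" for x
    using k that unfolding hom_def N_def by auto
  have g_closed: "?g a \<in> carrier H" if "a \<in> U \<times> UNIV" for a
    using that k_closed unfolding signed_image_def by auto
  have g_bar: "?g (lbar a) = inv\<^bsub>H\<^esub> ?g a" if "a \<in> U \<times> UNIV" for a
    using that k_closed unfolding signed_image_def lbar_def by auto
  have res: "lres a b \<in> U \<times> UNIV" if "a \<in> U \<times> UNIV" "b \<in> U \<times> UNIV" "ladj a b" for a b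
    using that turn_closed unfolding lres_def ladj_def by auto
  define ok where "ok a b \<longleftrightarrow> ?g a \<otimes>\<^bsub>H\<^esub> ?g (lres a b) = ?g b \<otimes>\<^bsub>H\<^esub> ?g (lres b a)" for a b
  have ok_sym: "ok a b \<Longrightarrow> ok b a" for a b by (simp add: ok_def)
  have positive: "ok (x, True) (y, True)" if xy: "x \<in> U" "y \<in> U" "{x, y} \<in> E" for x y
  proof -
    have c: "turn True x y \<in> U" "turn True y x \<in> U" using turn_closed xy edge_commute by auto
    then have "mclass ([x] @ [turn True x y]) = mclass ([y] @ [turn True y x])"
      using mclass_eq_iff[of "[x, turn True x y]" "[y, turn True y x]"] xy U_subset
        sim_swap[of "(x, True)" "(y, True)" "[]"] by (auto simp: ladj_def lres_def)
    then show ?thesis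
      using hom_K_mult[OF k, of "[x]" "[turn True x y]"] hom_K_mult[OF k, of "[y]" "[turn True y x]"]
        xy c by (simp add: ok_def signed_image_def lres_def)
  qed
  have flip: "ok a (lbar b)"
    if ab: "a \<in> U \<times> UNIV" "b \<in> U \<times> UNIV" "ladj a b" and "ok (lres (lbar b) a) b" for a b
  proof -
    have bar: "lbar b \<in> U \<times> UNIV" "ladj (lbar b) a" using ab bar_adj adj_sym by (auto simp: lbar_def)
    have "lres b (lres (lbar b) a) = a" using res_bar_res[OF bar(2)] by simp
    moreover have "lres (lres (lbar b) a) b = lres a b"
    proof -
      have "lres (lres (lbar b) a) (lbar b) = lres a (lbar b)"
        using res_res[OF adj_sym[OF bar(2)]] .
      moreover have "ladj (lres (lbar b) a) b" using adj_res[OF bar(2)] bar_adj bar_bar adj_sym by metis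
      ultimately show ?thesis using res_bar ab(3) bar_bar by metis
    qed
    ultimately have rel: "?g (lres (lbar b) a) \<otimes>\<^bsub>H\<^esub> ?g (lres a b) = ?g b \<otimes>\<^bsub>H\<^esub> ?g a"
      using \<open>ok (lres (lbar b) a) b\<close> by (simp add: ok_def)
    have c: "?g a \<in> carrier H" "?g b \<in> carrier H" "?g (lres a b) \<in> carrier H"
      "?g (lres (lbar b) a) \<in> carrier H"
      using g_closed res ab bar by auto
    have "?g a = inv\<^bsub>H\<^esub> ?g b \<otimes>\<^bsub>H\<^esub> (?g (lres (lbar b) a) \<otimes>\<^bsub>H\<^esub> ?g (lres a b))"
      unfolding rel using c by (simp add: H.m_assoc[symmetric])
    then have "?g a \<otimes>\<^bsub>H\<^esub> inv\<^bsub>H\<^esub> ?g (lres a b) = inv\<^bsub>H\<^esub> ?g b \<otimes>\<^bsub>H\<^esub> ?g (lres (lbar b) a)"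
      using c by (simp add: H.m_assoc)
    then show ?thesis
      using g_bar[OF ab(2)] g_bar[OF res[OF ab]] res_bar[OF ab(3)] by (simp add: ok_def)
  qed
  have mixed: "ok (x, True) (y, False)" if xy: "x \<in> U" "y \<in> U" "{x, y} \<in> E" for x y
    using flip[of "(x, True)" "(y, True)"] positive[of "turn False y x" y] xy turn_closed[of y x]
      turn_edge[of y x] edge_commute by (simp add: ladj_def lbar_def lres_def)
  have negative: "ok (x, False) (y, False)" if xy: "x \<in> U" "y \<in> U" "{x, y} \<in> E" for x y
    using flip[of "(x, False)" "(y, True)"] ok_sym[OF mixed[of y "turn False y x"]] xy
      turn_closed[of y x] turn_edge[of y x] edge_commute by (simp add: ladj_def lbar_def lres_def)
  have ok: "ok a b" if "a \<in> U \<times> UNIV" "b \<in> U \<times> UNIV" "ladj a b" for a b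
  proof -
    obtain x d y e where ab: "a = (x, d)" "b = (y, e)" by (cases a, cases b)
    then have xy: "x \<in> U" "y \<in> U" "{x, y} \<in> E" "{y, x} \<in> E"
      using that edge_commute by (auto simp: ladj_def)
    then show ?thesis unfolding ab
      using positive mixed negative ok_sym[OF mixed[OF xy(2,1,4)]] by (cases d; cases e) simp_all
  qed
  show ?thesis
    using signed_alphabet_axioms H.group_axioms
    by (intro evaluated_alphabet.intro evaluated_alphabet_axioms.intro)
      (use ok res g_closed g_bar in \<open>auto simp: ok_def lbar_def\<close>)
qed

lemma value_pos:
  assumes "group H" "k \<in> hom K H" "w \<in> lists U"
  shows "word_value H (signed_image H k) (positive w) = k (mclass w)"
proof -
  interpret H: group H by fact
  have c: "k (mclass w) \<in> carrier H" if "w \<in> lists U" for w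
    using that assms(2) by (auto simp: hom_def N_def)
  show ?thesis
    using assms(3)
  proof (induction w rule: lists.induct)
    case Nil
    have "k (mclass []) \<otimes>\<^bsub>H\<^esub> k (mclass []) = k (mclass [])" using hom_K_mult[OF assms(2), of "[]" "[]"] by simp
    then show ?case using c[of "[]"] H.l_cancel_one by auto
  next
    case (Cons x w)
    then show ?case using hom_K_mult[OF assms(2), of "[x]" w] by (simp add: signed_image_def)
  qed
qed

abbreviation "G \<equiv> enveloping_group K"

definition N_value :: "('v \<times> bool) list \<Rightarrow> ('v list set + 'v list set) list set" where
  "N_value = word_value G (signed_image G (enveloping_hom K))"

lemma group_G: "group G"
  by (rule enveloping_group_is_group[OF monoid_K])

lemmas evaluated_G = evaluated[OF group_G enveloping_hom_is_hom[OF monoid_K]]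

lemma N_value_pos: "w \<in> lists U \<Longrightarrow> N_value (positive w) = enveloping_hom K (mclass w)"
  unfolding N_value_def by (rule value_pos[OF group_G enveloping_hom_is_hom[OF monoid_K]])

lemma N_value_reduced:
  assumes "w \<in> lists (U \<times> UNIV)"
  obtains r where "r \<in> lists (U \<times> UNIV)" "foldr act w (cls []) = cls r" "N_value w = N_value r"
  using evaluated_alphabet.reduced_form[OF evaluated_G assms] unfolding N_value_def by metis

lemma N_value_sim: "r \<asymp> r' \<Longrightarrow> r \<in> lists (U \<times> UNIV) \<Longrightarrow> N_value r = N_value r'"
  unfolding N_value_def by (rule evaluated_alphabet.sim_val[OF evaluated_G])

text \<open>Each element of \<^term>\<open>N\<close> is the value of a positive word over \<open>U\<close>, and each formal inverse is the
value of a formally inverted word.\<close>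

lemma carrier_G: "carrier G = N_value ` lists (U \<times> UNIV)"
proof
  interpret ev: evaluated_alphabet ladj lres lbar G "U \<times> UNIV" "signed_image G (enveloping_hom K)"
    by (rule evaluated_G)
  have elements: "\<exists>v\<in>lists (U \<times> UNIV). enveloping_cong K `` {s} = N_value v"
    if "s \<in> lists (N <+> N)" for s
    using that
  proof (induction s rule: lists.induct)
    case Nil
    show ?case using enveloping_one[OF monoid_K] by (intro bexI[of _ "[]"]) (simp_all add: N_value_def)
  next
    case (Cons a s)
    obtain n where n: "n \<in> N" "a = Inl n \<or> a = Inr n" using Cons(1) by blast
    then obtain u where u: "u \<in> lists U" "n = mclass u" by (auto simp: N_def)
    have pos_u: "positive u \<in> lists (U \<times> UNIV)" using u(1) by (auto simp: positive_def)
    have c: "[Inl n] \<in> lists (carrier K <+> carrier K)" "[Inr n] \<in> lists (carrier K <+> carrier K)"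
      "s \<in> lists (carrier K <+> carrier K)" "[a] \<in> lists (carrier K <+> carrier K)"
      using n Cons by auto
    have l: "enveloping_cong K `` {[Inl n]} = N_value (positive u)"
      using N_value_pos[OF u(1)] u(2) by (simp add: enveloping_hom_def)
    have "enveloping_cong K `` {[Inr n]} \<otimes>\<^bsub>G\<^esub> enveloping_cong K `` {[Inl n]} = \<one>\<^bsub>G\<^esub>"
      using enveloping_mult[OF monoid_K c(2,1)] enveloping_one[OF monoid_K]
        enveloping_rel[OF monoid_K, of "[Inr n, Inl n]" "[]"] n(1)
      by (simp add: enveloping_relators_def)
    then have "inv\<^bsub>G\<^esub> (enveloping_cong K `` {[Inl n]}) = enveloping_cong K `` {[Inr n]}"
      using group.inv_equality[OF group_G] enveloping_class_carrier[OF monoid_K] c by metis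
    then have r: "enveloping_cong K `` {[Inr n]} = N_value (map lbar (rev (positive u)))"
      using ev.val_bar_rev[OF pos_u] l unfolding N_value_def by simp
    have "map lbar (rev (positive u)) \<in> lists (U \<times> UNIV)" using u(1) by (auto simp: positive_def lbar_def)
    then obtain t where t: "t \<in> lists (U \<times> UNIV)" "enveloping_cong K `` {[a]} = N_value t"
      using n(2) l r pos_u by blast
    obtain v where v: "v \<in> lists (U \<times> UNIV)" "enveloping_cong K `` {s} = N_value v"
      using Cons.IH by blast
    have "enveloping_cong K `` {a # s} = N_value (t @ v)"
      using enveloping_mult[OF monoid_K c(4,3)] ev.val_append[OF t(1) v(1)] t(2) v(2)
      unfolding N_value_def by simp
    then show ?case using t(1) v(1) by (intro bexI[of _ "t @ v"]) simp_all
  qed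
  then show "carrier G \<subseteq> N_value ` lists (U \<times> UNIV)"
    unfolding enveloping_carrier[OF monoid_K] by fastforce
  show "N_value ` lists (U \<times> UNIV) \<subseteq> carrier G"
    using ev.val_closed unfolding N_value_def by blast
qed

lemma hom_N_value:
  assumes "group H" "h \<in> hom G H" "w \<in> lists (U \<times> UNIV)"
  shows "h (N_value w) = word_value H (signed_image H (\<lambda>a. h (enveloping_hom K a))) w"
proof -
  interpret h: group_hom G H h
    using assms group_G by (simp add: group_hom_def group_hom_axioms_def)
  interpret ev: evaluated_alphabet ladj lres lbar G "U \<times> UNIV" "signed_image G (enveloping_hom K)"
    by (rule evaluated_G)
  show ?thesis using assms(3)
  proof (induction w rule: lists.induct)
    case (Cons a w)
    have "enveloping_hom K (mclass [fst a]) \<in> carrier G"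
      using enveloping_hom_is_hom[OF monoid_K] Cons(1) by (auto simp: hom_def N_def)
    then have "h (signed_image G (enveloping_hom K) a) = signed_image H (\<lambda>a. h (enveloping_hom K a)) a"
      by (simp add: signed_image_def)
    then show ?case
      using Cons ev.val_closed[OF Cons(2)] ev.g_closed[OF Cons(1)] by (simp add: N_value_def)
  qed (simp add: N_value_def)
qed

abbreviation "incl \<equiv> enveloping_map M (\<lambda>a. a)"

lemma incl_hom: "incl \<in> hom G (enveloping_group M)"
  by (rule enveloping_map_is_hom[OF monoid_M monoid_K inclusion_hom])

lemma incl_enveloping_hom: "a \<in> N \<Longrightarrow> incl (enveloping_hom K a) = enveloping_hom M a"
  using enveloping_map_enveloping_hom[OF monoid_M monoid_K inclusion_hom] by simp

lemma incl_N_value: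
  assumes "w \<in> lists (U \<times> UNIV)"
  shows "incl (N_value w) = M_value w"
proof -
  have "signed_image (enveloping_group M) (\<lambda>a. incl (enveloping_hom K a)) a
      = signed_image (enveloping_group M) (enveloping_hom M) a" if "a \<in> U \<times> UNIV" for a
    using that incl_enveloping_hom[of "mclass [fst a]"] by (auto simp: signed_image_def N_def)
  then show ?thesis
    using assms
    unfolding hom_N_value[OF enveloping_group_is_group[OF monoid_M] incl_hom assms] M_value_def
    by (induction w) auto
qed

lemma image_eq: "enveloping_image M N = M_value ` lists (U \<times> UNIV)"
  unfolding enveloping_image_def carrier_G image_image by (rule image_cong) (simp_all add: incl_N_value)

end

section \<open>Normal forms in the enveloping group\<close>

context trickle_graph
begin

lemma whole_standard: "standard_submonoid V E leq \<mu> \<phi> V"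
  using edge_vertices turn_edge by unfold_locales blast+

lemma action_bijgroup:
  "group (BijGroup (UNIV :: ('v \<times> bool) list set set))"
  "carrier (BijGroup (UNIV :: ('v \<times> bool) list set set)) = {f. bij f}"
  "\<lbrakk>bij f; bij f'\<rbrakk> \<Longrightarrow> f \<otimes>\<^bsub>BijGroup (UNIV :: ('v \<times> bool) list set set)\<^esub> f' = f \<circ> f'"
  "\<one>\<^bsub>BijGroup (UNIV :: ('v \<times> bool) list set set)\<^esub> = id"
  by (rule group_BijGroup)
    (auto simp: BijGroup_def Bij_def compose_def fun_eq_iff extensional_def)

text \<open>The enveloping group acts on sets of signed words: positive words act compatibly with the monoid
relations, and the universal property extends this to the group.\<close>

lemma M_value_action: "\<exists>h. \<forall>w\<in>lists (V \<times> UNIV). h (M_value w) = foldr act w"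
proof -
  interpret whole: standard_submonoid V E leq \<mu> \<phi> V by (rule whole_standard)
  let ?B = "BijGroup (UNIV :: ('v \<times> bool) list set set)"
  note B = action_bijgroup
  have KM: "whole.K = M" by (simp add: whole.N_def flip: carrier_M)
  define k where "k A = foldr act (positive (SOME w. w \<in> lists V \<and> mclass w = A))" for A
  have k: "k (mclass w) = foldr act (positive w)" if "w \<in> lists V" for w
  proof -
    let ?w = "SOME w'. w' \<in> lists V \<and> mclass w' = mclass w"
    have "?w \<in> lists V \<and> mclass ?w = mclass w" by (rule someI[of _ w]) (simp add: that)
    then show ?thesis unfolding k_def using foldr_act_sim mclass_eq_iff that by blast
  qed
  have "k \<in> hom M ?B"
  proof (rule homI)
    show "k a \<in> carrier ?B" if "a \<in> carrier M" for a
    proof -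
      obtain u where "u \<in> lists V" "a = mclass u" using \<open>a \<in> carrier M\<close> by (rule carrier_M_E)
      then show ?thesis using k by (simp add: B foldr_act_bij)
    qed
    show "k (a \<otimes>\<^bsub>M\<^esub> b) = k a \<otimes>\<^bsub>?B\<^esub> k b" if ab: "a \<in> carrier M" "b \<in> carrier M" for a b
    proof -
      obtain u where u: "u \<in> lists V" "a = mclass u" using ab(1) by (rule carrier_M_E)
      obtain v where v: "v \<in> lists V" "b = mclass v" using ab(2) by (rule carrier_M_E)
      note uv = u v
      then have "u @ v \<in> lists V" by simp
      then show ?thesis using uv k[of "u @ v"] by (simp add: mult_M k B foldr_act_bij comp_def fun_eq_iff)
    qed
  qed
  then obtain h where h: "h \<in> hom (enveloping_group M) ?B"
    "\<And>a. a \<in> carrier M \<Longrightarrow> h (enveloping_hom M a) = k a"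
    using enveloping_group_universal[OF monoid_M B(1)] by blast
  have gen: "signed_image ?B (\<lambda>a. h (enveloping_hom M a)) a = act a" if "a \<in> V \<times> UNIV" for a
  proof -
    have x: "fst a \<in> V" using that by auto
    then have hx: "h (enveloping_hom M (mclass [fst a])) = act (fst a, True)"
      using h(2)[of "mclass [fst a]"] k[of "[fst a]"] by (simp add: carrier_M comp_def fun_eq_iff)
    have "inv\<^bsub>?B\<^esub> (act (fst a, True)) = act (fst a, False)"
    proof (rule group.inv_equality[OF B(1)])
      show "act (fst a, False) \<otimes>\<^bsub>?B\<^esub> act (fst a, True) = \<one>\<^bsub>?B\<^esub>"
        using act_inverse[of "(fst a, False)"] by (simp add: B act_bij fun_eq_iff lbar_def)
    qed (simp_all add: B act_bij)
    then show ?thesis using hx by (cases a) (auto simp: signed_image_def)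
  qed
  have "h (M_value w) = foldr act w" if w: "w \<in> lists (V \<times> UNIV)" for w
  proof -
    have "h (M_value w) = word_value ?B (signed_image ?B (\<lambda>a. h (enveloping_hom M a))) w"
      using whole.hom_N_value[OF B(1), of h] h(1) w
      unfolding KM whole.N_value_def M_value_def by blast
    also have "\<dots> = foldr act w"
      using w by (induction w rule: lists.induct) (simp_all add: B gen act_bij foldr_act_bij)
    finally show ?thesis .
  qed
  then show ?thesis by blast
qed

lemma M_value_normal_form:
  assumes "M_value w = M_value w'" "w \<in> lists (V \<times> UNIV)" "w' \<in> lists (V \<times> UNIV)"
  shows "foldr act w = foldr act w'"
  using M_value_action assms by metis

lemma M_value_pos: "w \<in> lists V \<Longrightarrow> M_value (positive w) = enveloping_hom M (mclass w)"
proof -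
  interpret whole: standard_submonoid V E leq \<mu> \<phi> V by (rule whole_standard)
  have "whole.K = M" by (simp add: whole.N_def flip: carrier_M)
  then show "w \<in> lists V \<Longrightarrow> ?thesis"
    using whole.N_value_pos[of w] unfolding whole.N_value_def M_value_def by simp
qed

end

context standard_submonoid
begin

lemma signed_lists_U_V: "w \<in> lists (U \<times> UNIV) \<Longrightarrow> w \<in> lists (V \<times> UNIV)"
  using U_subset by auto

text \<open>Words over \<open>U\<close> with the same value in the group of \<^term>\<open>M\<close> have the same reduced form up
to moves, and a word is equal to its reduced form already in the group of \<^term>\<open>N\<close>.\<close>

lemma incl_inj: "inj_on incl (carrier G)"
proof (rule inj_onI)
  fix x y assume xy: "x \<in> carrier G" "y \<in> carrier G" "incl x = incl y"
  then obtain v w where v: "v \<in> lists (U \<times> UNIV)" "x = N_value v"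
    and w: "w \<in> lists (U \<times> UNIV)" "y = N_value w"
    unfolding carrier_G by blast
  obtain r where r: "r \<in> lists (U \<times> UNIV)" "foldr act v (cls []) = cls r" "N_value v = N_value r"
    using N_value_reduced[OF v(1)] .
  obtain s where s: "s \<in> lists (U \<times> UNIV)" "foldr act w (cls []) = cls s" "N_value w = N_value s"
    using N_value_reduced[OF w(1)] .
  have "foldr act v = foldr act w"
    using M_value_normal_form incl_N_value v w xy(3) signed_lists_U_V by metis
  then have "r \<asymp> s" using r s cls_eq_iff by metis
  then show "x = y" using N_value_sim r s v w by metis
qed

text \<open>The positive word is itself reduced, so it is equivalent to the reduced form over \<open>U\<close> of the same
group element, and is a word over \<open>U\<close>.\<close>

lemma positive_in_image:
  assumes "w \<in> lists V" "enveloping_hom M (mclass w) \<in> enveloping_image M N"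
  shows "mclass w \<in> N"
proof -
  obtain v where v: "v \<in> lists (U \<times> UNIV)" "M_value v = M_value (positive w)"
    using assms M_value_pos unfolding image_eq by (metis imageE)
  have "positive w \<in> lists (V \<times> UNIV)" using assms(1) by (auto simp: positive_def)
  then have "foldr act v = foldr act (positive w)"
    using M_value_normal_form v signed_lists_U_V by blast
  moreover obtain r where r: "r \<in> lists (U \<times> UNIV)" "foldr act v (cls []) = cls r"
    by (rule N_value_reduced[OF v(1)])
  ultimately have "r \<asymp> positive w"
    using foldr_act_reduced[OF reduced_pos[OF assms(1)]] cls_eq_iff by metis
  then have "positive w \<in> lists (U \<times> UNIV)"
    using evaluated_alphabet.sim_lists[OF evaluated_G] r(1) by blast
  then have "w \<in> lists U" by (auto simp: positive_def)
  then show ?thesis by (auto simp: N_def)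
qed

end

text \<open>A common element has one reduced form up to moves, and moves leave neither vertex set.\<close>

lemma (in trickle_graph) standard_Int:
  assumes "standard_submonoid V E leq \<mu> \<phi> U\<^sub>1" "standard_submonoid V E leq \<mu> \<phi> U\<^sub>2"
  shows "standard_submonoid V E leq \<mu> \<phi> (U\<^sub>1 \<inter> U\<^sub>2)"
    and "M_value ` lists (U\<^sub>1 \<times> UNIV) \<inter> M_value ` lists (U\<^sub>2 \<times> UNIV)
      = M_value ` lists ((U\<^sub>1 \<inter> U\<^sub>2) \<times> UNIV)"
proof -
  interpret N1: standard_submonoid V E leq \<mu> \<phi> U\<^sub>1 by fact
  interpret N2: standard_submonoid V E leq \<mu> \<phi> U\<^sub>2 by fact
  show "standard_submonoid V E leq \<mu> \<phi> (U\<^sub>1 \<inter> U\<^sub>2)"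
    using N1.U_subset N1.turn_closed N2.turn_closed by unfold_locales blast+
  have common: "\<exists>t\<in>lists ((U\<^sub>1 \<inter> U\<^sub>2) \<times> UNIV). M_value v = M_value t"
    if v: "v \<in> lists (U\<^sub>1 \<times> UNIV)" and w: "w \<in> lists (U\<^sub>2 \<times> UNIV)" and eq: "M_value v = M_value w"
    for v w
  proof -
    obtain r where r: "r \<in> lists (U\<^sub>1 \<times> UNIV)" "foldr act v (cls []) = cls r"
      "N1.N_value v = N1.N_value r"
      using N1.N_value_reduced[OF v] .
    obtain s where s: "s \<in> lists (U\<^sub>2 \<times> UNIV)" "foldr act w (cls []) = cls s"
      by (rule N2.N_value_reduced[OF w])
    have "foldr act v = foldr act w"
      using M_value_normal_form[OF eq] v w N1.signed_lists_U_V N2.signed_lists_U_V by blast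
    then have "s \<asymp> r" using r(2) s(2) cls_eq_iff by metis
    then have "r \<in> lists (U\<^sub>2 \<times> UNIV)"
      using evaluated_alphabet.sim_lists[OF N2.evaluated_G] s(1) by blast
    then have "r \<in> lists ((U\<^sub>1 \<inter> U\<^sub>2) \<times> UNIV)" using r(1) by auto
    moreover have "M_value v = M_value r" using N1.incl_N_value v r by metis
    ultimately show ?thesis by blast
  qed
  let ?im = "\<lambda>U. M_value ` lists (U \<times> UNIV)"
  show "?im U\<^sub>1 \<inter> ?im U\<^sub>2 = ?im (U\<^sub>1 \<inter> U\<^sub>2)"
  proof (intro equalityI Int_greatest subsetI)
    fix x assume "x \<in> ?im U\<^sub>1 \<inter> ?im U\<^sub>2"
    then have 1: "x \<in> ?im U\<^sub>1" and 2: "x \<in> ?im U\<^sub>2" by simp_all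
    obtain v where v: "x = M_value v" "v \<in> lists (U\<^sub>1 \<times> UNIV)" using 1 by (rule imageE)
    obtain w where w: "x = M_value w" "w \<in> lists (U\<^sub>2 \<times> UNIV)" using 2 by (rule imageE)
    show "x \<in> ?im (U\<^sub>1 \<inter> U\<^sub>2)" using common[OF v(2) w(2)] v(1) w(1) by (metis imageI)
  next
    fix x assume x: "x \<in> ?im (U\<^sub>1 \<inter> U\<^sub>2)"
    have "?im (U\<^sub>1 \<inter> U\<^sub>2) \<subseteq> ?im U\<^sub>1" by (intro image_mono lists_mono) auto
    then show "x \<in> ?im U\<^sub>1" using x by (rule subsetD)
    have "?im (U\<^sub>1 \<inter> U\<^sub>2) \<subseteq> ?im U\<^sub>2" by (intro image_mono lists_mono) auto
    then show "x \<in> ?im U\<^sub>2" using x by (rule subsetD)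
  qed
qed

lemma parabolic_Int:
  assumes "parabolic_submonoid N\<^sub>1 M" "parabolic_submonoid N\<^sub>2 M"
  shows "parabolic_submonoid (N\<^sub>1 \<inter> N\<^sub>2) M"
proof -
  have "submonoid (N\<^sub>1 \<inter> N\<^sub>2) M"
    using assms unfolding parabolic_submonoid_def special_submonoid_def submonoid_def by blast
  then show ?thesis
    using assms unfolding parabolic_submonoid_def special_submonoid_def by blast
qed

theorem theorem2p18:
  fixes V :: "'v set" and E :: "'v set set" and leq :: "'v \<Rightarrow> 'v \<Rightarrow> bool"
    and \<mu> :: "'v \<Rightarrow> enat" and \<phi> :: "'v \<Rightarrow> 'v \<Rightarrow> 'v" and M :: "'v list set monoid"
  assumes "preGarside_trickle_graph V E leq \<mu> \<phi>"
    and "M = trickle_monoid V E \<phi>"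
  shows
    "(\<forall>N. parabolic_submonoid N M \<longrightarrow>
        enveloping_map M (\<lambda>a. a) \<in> mon (enveloping_group (M\<lparr>carrier := N\<rparr>)) (enveloping_group M)
      \<and> (\<forall>a\<in>N. enveloping_map M (\<lambda>a. a) (enveloping_hom (M\<lparr>carrier := N\<rparr>) a) = enveloping_hom M a)
      \<and> subgroup (enveloping_image M N) (enveloping_group M))
   \<and> (\<forall>N. parabolic_submonoid N M \<longrightarrow>
        enveloping_hom M ` carrier M \<inter> enveloping_image M N = enveloping_hom M ` N)
   \<and> (\<forall>N\<^sub>1 N\<^sub>2. parabolic_submonoid N\<^sub>1 M \<longrightarrow> parabolic_submonoid N\<^sub>2 M \<longrightarrow>
        parabolic_submonoid (N\<^sub>1 \<inter> N\<^sub>2) M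
      \<and> enveloping_image M N\<^sub>1 \<inter> enveloping_image M N\<^sub>2 = enveloping_image M (N\<^sub>1 \<inter> N\<^sub>2))"
proof -
  interpret preGarside_trickle_graph V E leq \<mu> \<phi> by (rule assms(1))
  define S where "S N = {x \<in> V. mclass [x] \<in> N}" for N
  have std: "standard_submonoid V E leq \<mu> \<phi> (S N)" and N: "N = mclass ` lists (S N)"
    if "parabolic_submonoid N M" for N
    using parabolic_standard[of N] that unfolding assms(2) S_def by blast+
  have image: "enveloping_image M N = M_value ` lists (S N \<times> UNIV)" if p: "parabolic_submonoid N M" for N
  proof -
    interpret N: standard_submonoid V E leq \<mu> \<phi> "S N" by (rule std[OF p])
    show ?thesis using N.image_eq N[OF p] unfolding assms(2) N.N_def by simp
  qed
  show ?thesis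
  proof (intro conjI allI impI)
    fix N assume p: "parabolic_submonoid N M"
    interpret N: standard_submonoid V E leq \<mu> \<phi> "S N" by (rule std[OF p])
    have NN: "N.N = N" using N[OF p] by (simp add: N.N_def)
    interpret incl: group_hom "enveloping_group (M\<lparr>carrier := N\<rparr>)" "enveloping_group M"
      "enveloping_map M (\<lambda>a. a)"
      using N.incl_hom N.group_G enveloping_group_is_group[OF monoid_M]
      unfolding NN assms(2) by (simp add: group_hom_def group_hom_axioms_def)
    show "enveloping_map M (\<lambda>a. a) \<in> mon (enveloping_group (M\<lparr>carrier := N\<rparr>)) (enveloping_group M)"
      using N.incl_inj N.incl_hom unfolding NN assms(2) mon_def by simp
    show "\<forall>a\<in>N. enveloping_map M (\<lambda>a. a) (enveloping_hom (M\<lparr>carrier := N\<rparr>) a) = enveloping_hom M a"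
      using N.incl_enveloping_hom unfolding NN assms(2) by simp
    show "subgroup (enveloping_image M N) (enveloping_group M)"
      unfolding enveloping_image_def by (rule incl.img_is_subgroup)
    show "enveloping_hom M ` carrier M \<inter> enveloping_image M N = enveloping_hom M ` N"
    proof
      show "enveloping_hom M ` carrier M \<inter> enveloping_image M N \<subseteq> enveloping_hom M ` N"
        using N.positive_in_image unfolding NN assms(2) carrier_M by auto
      show "enveloping_hom M ` N \<subseteq> enveloping_hom M ` carrier M \<inter> enveloping_image M N"
      proof
        fix g assume "g \<in> enveloping_hom M ` N"
        then obtain w where w: "w \<in> lists (S N)" "g = enveloping_hom M (mclass w)"
          using N[OF p] by (metis imageE)
        then have wV: "w \<in> lists V" using N.lists_U_V by blast
        have "positive w \<in> lists (S N \<times> UNIV)" using w(1) by (auto simp: positive_def)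
        then have "g \<in> enveloping_image M N"
          unfolding image[OF p] using M_value_pos[OF wV] w(2) unfolding assms(2) by force
        then show "g \<in> enveloping_hom M ` carrier M \<inter> enveloping_image M N"
          using w(2) wV unfolding assms(2) carrier_M by blast
      qed
    qed
  next
    fix N\<^sub>1 N\<^sub>2 assume p: "parabolic_submonoid N\<^sub>1 M" "parabolic_submonoid N\<^sub>2 M"
    show p12: "parabolic_submonoid (N\<^sub>1 \<inter> N\<^sub>2) M" using p by (rule parabolic_Int)
    have "S (N\<^sub>1 \<inter> N\<^sub>2) = S N\<^sub>1 \<inter> S N\<^sub>2" by (auto simp: S_def)
    then show "enveloping_image M N\<^sub>1 \<inter> enveloping_image M N\<^sub>2 = enveloping_image M (N\<^sub>1 \<inter> N\<^sub>2)"
      using standard_Int(2)[OF std[OF p(1)] std[OF p(2)]] image p p12 by simp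
  qed
qed

end
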